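(* Let $A\in\mathbb{R}^{n\times n}$, $B\in\mathbb{R}^{n\times m}$, let $Q\in\mathbb{R}^{n\times n}$, $R\in\mathbb{R}^{m\times m}$ be symmetric positive definite, $\gamma\in(0,1)$, $x\in\mathbb{R}^n$, and let $K\in\mathbb{R}^{m\times n}$ be such that $A_K:=A+BK$ satisfies $\rho(A_K)<1$. Let $(w_k)_{k\ge 0}$ be i.i.d. random vectors in $\mathbb{R}^n$ with zero mean, positive definite covariance matrix $\Sigma$, and a distribution symmetric about the origin (that is, $w_k$ and $-w_k$ have the same distribution), let $w$ have the same distribution as $w_k$, and suppose $\mathbb{E}[\|w\|^4]=\phi^4<+\infty$. Let $P$ be the unique solution of $P=Q+K^\top RK+\gamma A_K^\top PA_K$, let $Z$ be the unique solution of $$Z-\gamma^2A_KZA_K^\top=A_K\Big(xx^\top+\frac{\gamma^2}{1-\gamma^2}\Sigma\Big)A_K^\top ,$$ and let $G^K(x)$ be the random return defined in the context. Then $$\operatorname{Var}[G^K(x)]\le\frac{\gamma^2}{1-\gamma^2}\|P\|^2\phi^4-\frac{\gamma^2}{1-\gamma^2}\big(\operatorname{tr}(P\Sigma)\big)^2+4\gamma^2\operatorname{tr}(P\Sigma PZ).$$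
   Context: $\rho(\cdot)$ denotes the spectral radius; $\|\cdot\|$ is the Euclidean norm for vectors and the spectral norm for matrices. The random return of the closed-loop system $x_{t+1}=A_Kx_t+v_t$, $x_0=x$ (with $v_t$ i.i.d. with the same law as $w_k$), namely $\sum_{t\ge0}\gamma^t x_t^\top(Q+K^\top RK)x_t$, is represented (equal in distribution) by $$G^K(x)=x^\top Px+2\sum_{k=0}^{\infty}\gamma^{k+1}w_k^\top PA_K^{k+1}x+\sum_{k=0}^{\infty}\gamma^{k+1}w_k^\top Pw_k+2\sum_{k=1}^{\infty}\gamma^{k+1}w_k^\top P\sum_{\tau=0}^{k-1}A_K^{k-\tau}w_\tau ,$$ and $G^K(x)$ denotes this random variable. *)

theory Defs
  imports "HOL-Probability.Probability"
begin

definition complex_eigenvalues :: "real^'n^'n \<Rightarrow> complex set" where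
  "complex_eigenvalues A =
     {z. \<exists>v. v \<noteq> 0 \<and> map_matrix complex_of_real A *v v = z *s v}"

definition spectral_radius :: "real^'n^'n \<Rightarrow> real" where
  "spectral_radius A = Max (cmod ` complex_eigenvalues A)"

definition sym_pos_def :: "real^'n^'n \<Rightarrow> bool" where
  "sym_pos_def A \<longleftrightarrow> transpose A = A \<and> (\<forall>v. v \<noteq> 0 \<longrightarrow> 0 < v \<bullet> (A *v v))"

(* The power operation of the type of square matrices acts componentwise. *)
primrec matpow :: "real^'n^'n \<Rightarrow> nat \<Rightarrow> real^'n^'n" where
  "matpow A 0 = mat 1"
| "matpow A (Suc k) = A ** matpow A k"

definition outer_prod :: "real^'n \<Rightarrow> real^'n \<Rightarrow> real^'n^'n" where
  "outer_prod u v = (\<chi> i j. u $ i * v $ j)"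

definition covariance_matrix :: "'a measure \<Rightarrow> ('a \<Rightarrow> real^'n) \<Rightarrow> real^'n^'n" where
  "covariance_matrix M X =
     (\<chi> i j. integral\<^sup>L M (\<lambda>\<omega>. (X \<omega> $ i - integral\<^sup>L M (\<lambda>\<xi>. X \<xi> $ i)) *
                              (X \<omega> $ j - integral\<^sup>L M (\<lambda>\<xi>. X \<xi> $ j))))"

(* F is the closed-loop matrix. The last series is shifted by one so as to range over
   k = 1, 2, ...; hence the exponent k + 2 and the bound Suc k. *)
definition random_return ::
  "real \<Rightarrow> real^'n^'n \<Rightarrow> real^'n^'n \<Rightarrow> (nat \<Rightarrow> 'a \<Rightarrow> real^'n) \<Rightarrow> real^'n \<Rightarrow> 'a \<Rightarrow> real" where
  "random_return \<gamma> F P w x \<omega> =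
     x \<bullet> (P *v x)
     + 2 * (\<Sum>k. \<gamma> ^ (k + 1) * (w k \<omega> \<bullet> (P *v (matpow F (k + 1) *v x))))
     + (\<Sum>k. \<gamma> ^ (k + 1) * (w k \<omega> \<bullet> (P *v w k \<omega>)))
     + 2 * (\<Sum>k. \<gamma> ^ (k + 2) *
              (w (Suc k) \<omega> \<bullet> (P *v (\<Sum>\<tau><Suc k. matpow F (Suc k - \<tau>) *v w \<tau> \<omega>))))"

end

theory Submission
  imports Defs "HOL-Computational_Algebra.Fundamental_Theorem_Algebra"
begin

text \<open>
  With \<open>y\<^sub>k = F x\<^sub>k\<close>, where \<open>x\<^sub>0 = x\<close> and \<open>x\<^sub>k\<^sub>+\<^sub>1 = F x\<^sub>k + w\<^sub>k\<close>, the centred return is almost surely the sum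
  of the terms \<open>\<gamma>\<^sup>k\<^sup>+\<^sup>1 (2 w\<^sub>k \<bullet> P y\<^sub>k + q(w\<^sub>k))\<close>, where \<open>q(v) = v \<bullet> P v - tr(P \<Sigma>)\<close>. Since \<open>y\<^sub>k\<close> depends only on the
  earlier noise and the law of \<open>w\<^sub>k\<close> is symmetric, these terms are orthogonal and the two parts of each term are
  orthogonal to each other. Hence the partial sums have second moment
  \<open>4 \<gamma>\<^sup>2 tr(P \<Sigma> P G\<^sub>n) + E[q(w)\<^sup>2] (\<gamma>\<^sup>2 + \<dots> + \<gamma>\<^sup>2\<^sup>n)\<close>, with \<open>G\<^sub>n\<close> the sum of \<open>\<gamma>\<^sup>2\<^sup>k E[y\<^sub>k y\<^sub>k\<^sup>T]\<close> over \<open>k < n\<close>.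
  The equation for \<open>Z\<close> gives \<open>G\<^sub>n \<le> Z\<close> in the Loewner order, and
  \<open>tr(P \<Sigma> P E) = E[(P w) \<bullet> E (P w)]\<close> is monotone in \<open>E\<close>. Fatou's lemma passes to the limit.
\<close>

section \<open>Power-boundedness\<close>

text \<open>This is p(A) v by Horner's rule. Folding over vectors keeps matrix powers out of the
  definition.\<close>

definition matrix_poly_apply :: "complex^'n^'n \<Rightarrow> complex poly \<Rightarrow> complex^'n \<Rightarrow> complex^'n" where
  "matrix_poly_apply A p v = fold_coeffs (\<lambda>a u. a *s v + A *v u) p 0"

lemma matrix_poly_apply_0 [simp]: "matrix_poly_apply A 0 v = 0"
  by (simp add: matrix_poly_apply_def)

lemma matrix_poly_apply_pCons [simp]:
  "matrix_poly_apply A (pCons a p) v = a *s v + A *v matrix_poly_apply A p v"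
  by (cases "p = 0 \<and> a = 0") (auto simp: matrix_poly_apply_def)

lemma matrix_poly_apply_add:
  "matrix_poly_apply A (p + q) v = matrix_poly_apply A p v + matrix_poly_apply A q v"
  by (induction p q rule: poly_induct2)
    (simp_all add: vector_sadd_rdistrib matrix_vector_right_distrib)

lemma matrix_poly_apply_smult:
  "matrix_poly_apply A (smult c p) v = c *s matrix_poly_apply A p v"
  by (induction p) (simp_all add: vector_add_ldistrib vector_scalar_commute)

lemma matrix_poly_apply_sum:
  "matrix_poly_apply A (sum f S) v = (\<Sum>i\<in>S. matrix_poly_apply A (f i) v)"
  by (induction S rule: infinite_finite_induct) (simp_all add: matrix_poly_apply_add)

lemma matrix_poly_apply_monom:
  "matrix_poly_apply A (monom c k) v = c *s (((*v) A ^^ k) v)"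
  by (induction k) (simp_all add: monom_0 monom_Suc vector_scalar_commute)

lemma matrix_poly_apply_linear_factor:
  "matrix_poly_apply A ([:- l, 1:] * q) v = A *v matrix_poly_apply A q v - l *s matrix_poly_apply A q v"
proof -
  have "[:- l, 1:] * q = pCons 0 q + smult (- l) q"
    by simp
  then show ?thesis
    by (simp only: matrix_poly_apply_add matrix_poly_apply_smult matrix_poly_apply_pCons) simp
qed

text \<open>The reason is that q(A) commutes with A - l. Together with the factorisation above it
  lets the vector (A - l) v inherit the annihilator q once (A - l) q(A) v = 0.\<close>

lemma matrix_poly_apply_shift:
  "matrix_poly_apply A q (A *v v - l *s v) = A *v matrix_poly_apply A q v - l *s matrix_poly_apply A q v"
  by (induction q)
    (simp_all add: vec.scale_right_diff_distrib vec.scale_right_distrib matrix_vector_right_distrib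
      matrix_vector_mult_diff_distrib vector_scalar_commute mult.commute)

lemma matrix_poly_apply_eigenvector:
  assumes "A *v v = l *s v"
  shows "matrix_poly_apply A p v = poly p l *s v"
  by (induction p) (simp_all add: vector_scalar_commute assms vector_sadd_rdistrib vector_smult_assoc mult.commute)

text \<open>One vector more than the dimension forces a relation. Since \<open>dependent\<close>
  speaks of sets, a sequence with a repeated value needs its own argument.\<close>

lemma real_dependence_of_sequence:
  fixes f :: "nat \<Rightarrow> 'a::euclidean_space"
  shows "\<exists>c d. (\<exists>i\<le>d. c i \<noteq> 0) \<and> (\<Sum>i\<le>d. c i *\<^sub>R f i) = 0"
proof (cases "inj f")
  case True
  define S where "S = f ` {..DIM('a)}"
  have inj: "inj_on f {..DIM('a)}"
    using True by (rule inj_on_subset) simp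
  have "card S = Suc (DIM('a))"
    unfolding S_def using inj by (simp add: card_image)
  then have "dependent S"
    by (intro dependent_biggerset) (auto simp: S_def)
  then obtain u where u: "\<exists>v\<in>S. u v \<noteq> 0" "(\<Sum>v\<in>S. u v *\<^sub>R v) = 0"
    by (subst (asm) dependent_finite) (auto simp: S_def)
  have "(\<Sum>i\<le>DIM('a). (u (f i)) *\<^sub>R f i) = 0"
    using u(2) unfolding S_def by (simp add: sum.reindex[OF inj])
  moreover have "\<exists>i\<le>DIM('a). u (f i) \<noteq> 0"
    using u(1) by (auto simp: S_def)
  ultimately show ?thesis
    apply -
    apply (rule exI[of _ "\<lambda>i. u (f i)"])
    apply (rule exI[of _ "DIM('a)"])
    apply simp
    done
next
  case False
  then obtain a b where "a \<noteq> b" "f a = f b"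
    by (auto simp: inj_def)
  then have "min a b < max a b" "f (min a b) = f (max a b)"
    by (auto simp: min_def max_def)
  then obtain i j where ij: "i < j" "f i = f j"
    by blast
  \<comment> \<open>The relation f j - f i = 0 of the repeated value.\<close>
  let ?c = "\<lambda>k. (if k = j then 1 else 0) - (if k = i then 1 else 0) :: real"
  have "(\<Sum>k\<le>j. ?c k *\<^sub>R f k) = (\<Sum>k\<le>j. (if k = j then f k else 0) - (if k = i then f k else 0))"
    by (intro sum.cong) auto
  also have "\<dots> = 0"
    using ij by (simp add: sum_subtractf)
  finally have "(\<Sum>k\<le>j. ?c k *\<^sub>R f k) = 0" .
  moreover have "?c j \<noteq> 0" using ij by simp
  ultimately show ?thesis
    apply -
    apply (rule exI[of _ ?c])
    apply (rule exI[of _ j])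
    apply auto
    done
qed

lemma matrix_power_apply:
  fixes A :: "complex^'n^'n"
  shows "(((**) A ^^ k) (mat 1)) *v v = ((*v) A ^^ k) v"
  by (induction k) (simp_all add: matrix_vector_mul_assoc [symmetric])

text \<open>The complex matrices form a real vector space of finite dimension, so the powers of A
  satisfy a nontrivial linear relation, whose coefficients give p. This weak form of the
  Cayley-Hamilton theorem needs no determinants.\<close>

lemma annihilating_polynomial:
  fixes A :: "complex^'n^'n"
  shows "\<exists>p. p \<noteq> 0 \<and> (\<forall>v. matrix_poly_apply A p v = 0)"
proof -
  obtain c d where cd: "\<exists>i\<le>d. c i \<noteq> 0"
      "(\<Sum>i\<le>d. c i *\<^sub>R ((**) A ^^ i) (mat 1)) = 0"
    using real_dependence_of_sequence[of "\<lambda>i. ((**) A ^^ i) (mat 1)"] by blast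
  define p where "p = (\<Sum>i\<le>d. monom (complex_of_real (c i)) i)"
  have coeff: "coeff p k = (if k \<le> d then complex_of_real (c k) else 0)" for k
    by (simp add: p_def coeff_sum if_distrib[of complex_of_real] cong: if_cong)
  have "p \<noteq> 0"
    using cd(1) coeff by (metis coeff_0 of_real_eq_0_iff)
  moreover have "matrix_poly_apply A p v = 0" for v
  proof -
    have "(\<Sum>i\<le>d. c i *\<^sub>R ((**) A ^^ i) (mat 1)) *v v =
        (\<Sum>i\<le>d. complex_of_real (c i) *s ((*v) A ^^ i) v)"
    proof -
      have "(\<Sum>i\<le>d. c i *\<^sub>R ((**) A ^^ i) (mat 1)) *v v =
          (\<Sum>i\<le>d. (c i *\<^sub>R ((**) A ^^ i) (mat 1)) *v v)"
        by (simp add: vec_eq_iff matrix_vector_mult_def sum_distrib_right) (intro allI sum.swap)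
      also have "\<dots> = (\<Sum>i\<le>d. complex_of_real (c i) *s ((*v) A ^^ i) v)"
        unfolding matrix_power_apply [symmetric] by (rule sum.cong [OF refl])
          (simp add: vec_eq_iff matrix_vector_mult_def scaleR_sum_right flip: scaleR_conv_of_real)
      finally show ?thesis .
    qed
    then show ?thesis
      by (simp add: cd(2) p_def matrix_poly_apply_sum matrix_poly_apply_monom)
  qed
  ultimately show ?thesis by blast
qed

lemma norm_vector_scalar_mult: "norm (c *s v) = cmod c * norm (v :: complex^'n)"
  by (simp add: norm_vec_def norm_mult L2_set_right_distrib)

text \<open>Induction on the degree of the annihilator, splitting off a root l by p = (X - l) q. If
  q(A) v = 0, the degree has dropped. Otherwise q(A) v is an eigenvector, so |l| < 1, while (A - l)
  v is annihilated by q and has a bounded orbit; the orbit of v then obeys a contracting recursion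
  with bounded input.\<close>

lemma bounded_orbit:
  fixes A :: "complex^'n^'n"
  assumes "p \<noteq> 0" "matrix_poly_apply A p v = 0"
    and eig: "\<And>l u. u \<noteq> 0 \<Longrightarrow> A *v u = l *s u \<Longrightarrow> cmod l < 1"
  shows "\<exists>C. \<forall>k. norm (((*v) A ^^ k) v) \<le> C"
  using assms(1,2)
proof (induction "degree p" arbitrary: p v rule: less_induct)
  case less
  show ?case
  proof (cases "degree p = 0")
    case True
    then obtain a where "p = [:a:]" by (metis degree_eq_zeroE)
    with less.prems have "v = 0" by simp
    moreover have "((*v) A ^^ k) 0 = 0" for k by (induction k) auto
    ultimately show ?thesis by auto
  next
    case False
    then obtain l where "poly p l = 0"
      using fundamental_theorem_of_algebra by (metis constant_degree)
    then obtain q where q: "p = [:- l, 1:] * q"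
      by (auto simp: poly_eq_0_iff_dvd)
    with less.prems have "q \<noteq> 0" by auto
    have deg: "degree q < degree p"
      using \<open>q \<noteq> 0\<close> unfolding q by (subst degree_mult_eq) auto
    define u where "u = matrix_poly_apply A q v"
    have Au: "A *v u = l *s u"
      using less.prems(2) unfolding q matrix_poly_apply_linear_factor u_def by simp
    show ?thesis
    proof (cases "u = 0")
      case True
      then show ?thesis
        using less.hyps[OF deg \<open>q \<noteq> 0\<close>] by (simp add: u_def)
    next
      case False
      then have l: "cmod l < 1" using eig Au by blast
      define v' where "v' = A *v v - l *s v"
      have "matrix_poly_apply A q v' = 0"
        using Au by (simp add: v'_def matrix_poly_apply_shift u_def)
      then obtain D where D: "\<And>k. norm (((*v) A ^^ k) v') \<le> D"
        using less.hyps[OF deg \<open>q \<noteq> 0\<close>] by blast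
      have step: "((*v) A ^^ Suc k) v = l *s ((*v) A ^^ k) v + ((*v) A ^^ k) v'" for k
        by (induction k)
          (simp_all add: v'_def matrix_vector_right_distrib vector_scalar_commute)
      \<comment> \<open>The second entry is the fixed point of r = |l| r + D, so \<open>C\<close>
        dominates the start and is preserved by the recursion.\<close>
      define C where "C = max (norm v) (D / (1 - cmod l))"
      have "norm (((*v) A ^^ k) v) \<le> C" for k
      proof (induction k)
        case 0
        then show ?case by (simp add: C_def)
      next
        case (Suc k)
        have "norm (((*v) A ^^ Suc k) v) \<le> cmod l * norm (((*v) A ^^ k) v) + D"
          unfolding step
          by (rule norm_triangle_le) (simp only: norm_vector_scalar_mult add_left_mono D)
        also have "\<dots> \<le> cmod l * C + D"
          using Suc by (simp add: mult_left_mono)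
        also have "\<dots> \<le> C"
        proof -
          have "D / (1 - cmod l) \<le> C" by (simp add: C_def)
          then show ?thesis using l by (simp add: field_simps)
        qed
        finally show ?case .
      qed
      then show ?thesis by blast
    qed
  qed
qed

section \<open>Powers of a real matrix with spectral radius below one\<close>

text \<open>All eigenvalues are roots of one annihilating polynomial. Finiteness is what makes the
  \<open>Max\<close> in \<open>spectral_radius\<close> an upper bound for their moduli.\<close>

lemma finite_complex_eigenvalues: "finite (complex_eigenvalues A)"
proof -
  obtain p where p: "p \<noteq> 0" "\<And>v. matrix_poly_apply (map_matrix complex_of_real A) p v = 0"
    using annihilating_polynomial by blast
  have "complex_eigenvalues A \<subseteq> {z. poly p z = 0}"
    using p(2) by (auto simp: complex_eigenvalues_def dest!: matrix_poly_apply_eigenvector[of _ _ _ p])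
  then show ?thesis
    using poly_roots_finite[OF p(1)] finite_subset by blast
qed

text \<open>Complexification preserves norms and intertwines the two actions, so each basis vector
  has a bounded orbit; adding these bounds makes the constant uniform in v. Geometric decay is not
  sought: later the discount factor supplies it.\<close>

lemma matpow_bounded:
  fixes F :: "real^'n^'n"
  assumes "spectral_radius F < 1"
  shows "\<exists>C. \<forall>k v. norm (matpow F k *v v) \<le> C * norm v"
proof -
  define A where "A = map_matrix complex_of_real F"
  define cv :: "real^'n \<Rightarrow> complex^'n" where "cv v = (\<chi> i. complex_of_real (v $ i))" for v
  have cv: "A *v cv v = cv (F *v v)" for v
    by (simp add: A_def cv_def vec_eq_iff matrix_vector_mult_def map_matrix_def)
  have cvk: "((*v) A ^^ k) (cv v) = cv (matpow F k *v v)" for k v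
    by (induction k) (simp_all add: cv matrix_vector_mul_assoc)
  have norm_cv: "norm (cv v) = norm v" for v
    by (simp add: cv_def norm_vec_def)
  have "cmod l < 1" if "u \<noteq> 0" "A *v u = l *s u" for l u
  proof -
    have "l \<in> complex_eigenvalues F"
      using that by (auto simp: complex_eigenvalues_def A_def)
    then have "cmod l \<le> spectral_radius F"
      unfolding spectral_radius_def by (intro Max_ge) (auto simp: finite_complex_eigenvalues)
    then show ?thesis using assms by simp
  qed
  then have "\<exists>C. \<forall>k. norm (((*v) A ^^ k) v) \<le> C" for v
    using annihilating_polynomial[of A] bounded_orbit[of _ A v] by metis
  then have "\<forall>i. \<exists>C. \<forall>k. norm (matpow F k *v axis i 1) \<le> C"
    by (metis cvk norm_cv)
  then obtain C where C: "\<And>i k. norm (matpow F k *v axis i 1) \<le> C i" by metis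
  have "norm (matpow F k *v v) \<le> (\<Sum>i\<in>UNIV. C i) * norm v" for k v
  proof -
    have "matpow F k *v v = (\<Sum>i\<in>UNIV. v $ i *\<^sub>R (matpow F k *v axis i 1))"
      by (simp add: vec_eq_iff matrix_vector_mult_def axis_def if_distrib mult.commute cong: if_cong)
    also have "norm \<dots> \<le> (\<Sum>i\<in>UNIV. norm v * C i)"
      by (intro sum_norm_le)
        (auto intro!: mult_mono C simp: component_le_norm_cart)
    finally show ?thesis by (simp add: sum_distrib_right sum_distrib_left mult.commute)
  qed
  then show ?thesis by blast
qed

section \<open>Square-integrable random vectors\<close>

definition square_integrable :: "'a measure \<Rightarrow> ('a \<Rightarrow> 'b::euclidean_space) \<Rightarrow> bool" where
  "square_integrable M f \<longleftrightarrow> f \<in> borel_measurable M \<and> integrable M (\<lambda>\<omega>. (norm (f \<omega>))\<^sup>2)"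

lemma square_integrable_bound:
  assumes f: "square_integrable M f" and g: "g \<in> borel_measurable M"
    and le: "\<And>\<omega>. norm (g \<omega>) \<le> C * norm (f \<omega>)"
  shows "square_integrable M g"
proof -
  have [measurable]: "f \<in> borel_measurable M" "g \<in> borel_measurable M"
    using f g by (auto simp: square_integrable_def)
  have "integrable M (\<lambda>\<omega>. C\<^sup>2 * (norm (f \<omega>))\<^sup>2)"
    using f by (simp add: square_integrable_def)
  then have "integrable M (\<lambda>\<omega>. (norm (g \<omega>))\<^sup>2)"
  proof (rule Bochner_Integration.integrable_bound)
    show "AE \<omega> in M. norm ((norm (g \<omega>))\<^sup>2) \<le> norm (C\<^sup>2 * (norm (f \<omega>))\<^sup>2)"
      using power_mono[OF le norm_ge_zero, where n = 2] by (auto simp: power_mult_distrib)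
  qed simp
  then show ?thesis using g by (simp add: square_integrable_def)
qed

lemma square_integrable_add:
  assumes "square_integrable M f" "square_integrable M g"
  shows "square_integrable M (\<lambda>\<omega>. f \<omega> + g \<omega>)"
proof -
  have [measurable]: "f \<in> borel_measurable M" "g \<in> borel_measurable M"
    using assms by (auto simp: square_integrable_def)
  have "integrable M (\<lambda>\<omega>. 2 * (norm (f \<omega>))\<^sup>2 + 2 * (norm (g \<omega>))\<^sup>2)"
    using assms by (simp add: square_integrable_def)
  then have "integrable M (\<lambda>\<omega>. (norm (f \<omega> + g \<omega>))\<^sup>2)"
  proof (rule Bochner_Integration.integrable_bound)
    have "(norm (f \<omega> + g \<omega>))\<^sup>2 \<le> 2 * (norm (f \<omega>))\<^sup>2 + 2 * (norm (g \<omega>))\<^sup>2" for \<omega>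
    proof -
      have "(norm (f \<omega> + g \<omega>))\<^sup>2 \<le> (norm (f \<omega>) + norm (g \<omega>))\<^sup>2"
        by (intro power_mono norm_triangle_ineq) auto
      then show ?thesis
        using zero_le_power2[of "norm (f \<omega>) - norm (g \<omega>)"]
        by (simp add: power2_sum power2_diff)
    qed
    then show "AE \<omega> in M. norm ((norm (f \<omega> + g \<omega>))\<^sup>2) \<le> norm (2 * (norm (f \<omega>))\<^sup>2 + 2 * (norm (g \<omega>))\<^sup>2)"
      by auto
  qed simp
  then show ?thesis by (simp add: square_integrable_def)
qed

lemma square_integrable_bounded_linear:
  assumes "square_integrable M f" "bounded_linear h"
  shows "square_integrable M (\<lambda>\<omega>. h (f \<omega>))"
proof -
  obtain C where C: "\<And>v. norm (h v) \<le> norm v * C"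
    using bounded_linear.bounded[OF assms(2)] by blast
  have "f \<in> borel_measurable M"
    using assms by (simp add: square_integrable_def)
  then have "(\<lambda>\<omega>. h (f \<omega>)) \<in> borel_measurable M"
    by (rule borel_measurable_continuous_on[OF linear_continuous_on[OF assms(2)]])
  with assms(1) show ?thesis
    by (rule square_integrable_bound[where C = C]) (use C in \<open>simp add: mult.commute\<close>)
qed

lemma square_integrable_nth:
  fixes f :: "'a \<Rightarrow> real^'n"
  shows "square_integrable M f \<Longrightarrow> square_integrable M (\<lambda>\<omega>. f \<omega> $ i)"
  by (rule square_integrable_bounded_linear[OF _ bounded_linear_vec_nth])

lemma square_integrable_matrix_vector_mult:
  fixes f :: "'a \<Rightarrow> real^'n"
  shows "square_integrable M f \<Longrightarrow> square_integrable M (\<lambda>\<omega>. A *v f \<omega>)"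
  by (rule square_integrable_bounded_linear) (auto simp: linear_conv_bounded_linear[symmetric])

lemma (in finite_measure) square_integrable_const: "square_integrable M (\<lambda>_. c)"
  by (simp add: square_integrable_def)

lemma square_integrable_mult:
  fixes f g :: "'a \<Rightarrow> real"
  assumes "square_integrable M f" "square_integrable M g"
  shows "integrable M (\<lambda>\<omega>. f \<omega> * g \<omega>)"
proof -
  have [measurable]: "f \<in> borel_measurable M" "g \<in> borel_measurable M"
    using assms by (auto simp: square_integrable_def)
  have "integrable M (\<lambda>\<omega>. (f \<omega>)\<^sup>2 + (g \<omega>)\<^sup>2)"
    using assms by (simp add: square_integrable_def)
  then show ?thesis
  proof (rule Bochner_Integration.integrable_bound)
    have "\<bar>f \<omega> * g \<omega>\<bar> \<le> (f \<omega>)\<^sup>2 + (g \<omega>)\<^sup>2" for \<omega>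
    proof -
      have "2 * \<bar>f \<omega>\<bar> * \<bar>g \<omega>\<bar> \<le> \<bar>f \<omega>\<bar>\<^sup>2 + \<bar>g \<omega>\<bar>\<^sup>2"
        by (rule sum_squares_bound)
      moreover have "0 \<le> \<bar>f \<omega>\<bar> * \<bar>g \<omega>\<bar>" by simp
      ultimately show ?thesis
        unfolding abs_mult power2_abs by linarith
    qed
    then show "AE \<omega> in M. norm (f \<omega> * g \<omega>) \<le> norm ((f \<omega>)\<^sup>2 + (g \<omega>)\<^sup>2)"
      by auto
  qed simp
qed

lemma (in finite_measure) square_integrable_imp_integrable:
  assumes "square_integrable M f"
  shows "integrable M f"
proof -
  have [measurable]: "f \<in> borel_measurable M"
    using assms by (simp add: square_integrable_def)
  have "integrable M (\<lambda>\<omega>. norm (f \<omega>) * 1)"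
    by (rule square_integrable_mult[OF _ square_integrable_const])
      (use assms in \<open>simp add: square_integrable_def\<close>)
  then show ?thesis
    by (simp add: integrable_norm_iff)
qed

text \<open>Left uncentred: the vectors \<open>drift n\<close> below need not have mean zero, and
  their means contribute the term x x^T in the equation for Z.\<close>

definition second_moment :: "'a measure \<Rightarrow> ('a \<Rightarrow> real^'n) \<Rightarrow> real^'n^'n" where
  "second_moment M u = (\<chi> i j. \<integral>\<omega>. u \<omega> $ i * u \<omega> $ j \<partial>M)"

lemma has_bochner_integral_second_moment:
  assumes "square_integrable M u"
  shows "has_bochner_integral M (\<lambda>\<omega>. u \<omega> $ i * u \<omega> $ j) (second_moment M u $ i $ j)"
  using square_integrable_mult[OF square_integrable_nth[OF assms] square_integrable_nth[OF assms]]
  by (simp add: second_moment_def has_bochner_integral_integrable)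

lemma second_moment_matrix_vector_mult:
  fixes u :: "'a \<Rightarrow> real^'n" and F :: "real^'n^'n"
  assumes "square_integrable M u"
  shows "second_moment M (\<lambda>\<omega>. F *v u \<omega>) = F ** second_moment M u ** transpose F"
proof -
  have "has_bochner_integral M (\<lambda>\<omega>. (F *v u \<omega>) $ i * (F *v u \<omega>) $ j)
      ((F ** second_moment M u ** transpose F) $ i $ j)" for i j
  proof -
    have "has_bochner_integral M
       (\<lambda>\<omega>. \<Sum>b\<in>UNIV. \<Sum>a\<in>UNIV. (F $ i $ a * F $ j $ b) * (u \<omega> $ a * u \<omega> $ b))
       (\<Sum>b\<in>UNIV. \<Sum>a\<in>UNIV. (F $ i $ a * F $ j $ b) * second_moment M u $ a $ b)"
      by (intro has_bochner_integral_sum has_bochner_integral_mult_right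
        has_bochner_integral_second_moment assms)
    moreover have "(\<Sum>b\<in>UNIV. \<Sum>a\<in>UNIV. (F $ i $ a * F $ j $ b) * (u \<omega> $ a * u \<omega> $ b))
        = (F *v u \<omega>) $ i * (F *v u \<omega>) $ j" for \<omega>
      by (subst sum.swap) (simp add: matrix_vector_mult_def sum_product ac_simps)
    moreover have "(\<Sum>b\<in>UNIV. \<Sum>a\<in>UNIV. (F $ i $ a * F $ j $ b) * second_moment M u $ a $ b)
        = (F ** second_moment M u ** transpose F) $ i $ j"
      by (simp add: matrix_matrix_mult_def transpose_def sum_distrib_left sum_distrib_right ac_simps)
    ultimately show ?thesis by simp
  qed
  then show ?thesis
    by (simp add: vec_eq_iff second_moment_def has_bochner_integral_integral_eq)
qed

lemma has_bochner_integral_quadratic_form: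
  fixes u :: "'a \<Rightarrow> real^'n"
  assumes "square_integrable M u"
  shows "has_bochner_integral M (\<lambda>\<omega>. u \<omega> \<bullet> (E *v u \<omega>)) (trace (E ** second_moment M u))"
proof -
  have "has_bochner_integral M (\<lambda>\<omega>. \<Sum>a\<in>UNIV. \<Sum>b\<in>UNIV. E $ a $ b * (u \<omega> $ b * u \<omega> $ a))
     (\<Sum>a\<in>UNIV. \<Sum>b\<in>UNIV. E $ a $ b * second_moment M u $ b $ a)"
    by (intro has_bochner_integral_sum has_bochner_integral_mult_right
      has_bochner_integral_second_moment assms)
  moreover have "(\<Sum>a\<in>UNIV. \<Sum>b\<in>UNIV. E $ a $ b * (u \<omega> $ b * u \<omega> $ a)) = u \<omega> \<bullet> (E *v u \<omega>)" for \<omega>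
    by (simp add: inner_vec_def matrix_vector_mult_def sum_distrib_left ac_simps)
  moreover have "(\<Sum>a\<in>UNIV. \<Sum>b\<in>UNIV. E $ a $ b * second_moment M u $ b $ a) = trace (E ** second_moment M u)"
    by (simp add: trace_def matrix_matrix_mult_def)
  ultimately show ?thesis by simp
qed

section \<open>Almost sure summability and passage to the limit\<close>

text \<open>By monotone convergence the expected sum of the absolute values is at most the sum of
  the \<open>B k\<close>. A random variable with finite expectation is finite almost
  everywhere.\<close>

lemma AE_summable_of_integral_bound:
  fixes f :: "nat \<Rightarrow> 'a \<Rightarrow> real"
  assumes [measurable]: "\<And>k. f k \<in> borel_measurable M"
    and g: "\<And>k. integrable M (g k)" "\<And>k \<omega>. \<bar>f k \<omega>\<bar> \<le> g k \<omega>"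
    and B: "\<And>k. integral\<^sup>L M (g k) \<le> B k" "summable B"
  shows "AE \<omega> in M. summable (\<lambda>k. f k \<omega>)"
proof -
  have g0: "0 \<le> g k \<omega>" for k \<omega>
    using g(2)[of k \<omega>] by (rule order_trans[OF abs_ge_zero])
  have B0: "0 \<le> B k" for k
    using Bochner_Integration.integral_nonneg[of M "g k"] g0 B(1)[of k] by (meson order_trans)
  have "(\<integral>\<^sup>+\<omega>. (\<Sum>k. ennreal \<bar>f k \<omega>\<bar>) \<partial>M) = (\<Sum>k. \<integral>\<^sup>+\<omega>. ennreal \<bar>f k \<omega>\<bar> \<partial>M)"
    by (rule nn_integral_suminf) measurable
  also have "\<dots> \<le> (\<Sum>k. ennreal (B k))"
  proof (rule suminf_le)
    fix k
    have "(\<integral>\<^sup>+\<omega>. ennreal \<bar>f k \<omega>\<bar> \<partial>M) \<le> (\<integral>\<^sup>+\<omega>. ennreal (g k \<omega>) \<partial>M)"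
      by (intro nn_integral_mono ennreal_leI g)
    also have "\<dots> = ennreal (integral\<^sup>L M (g k))"
      by (rule nn_integral_eq_integral) (auto simp: g g0)
    also have "\<dots> \<le> ennreal (B k)"
      by (intro ennreal_leI B)
    finally show "(\<integral>\<^sup>+\<omega>. ennreal \<bar>f k \<omega>\<bar> \<partial>M) \<le> ennreal (B k)" .
  qed auto
  also have "\<dots> = ennreal (\<Sum>k. B k)"
    by (rule suminf_ennreal2) (auto simp: B0 B)
  finally have "(\<integral>\<^sup>+\<omega>. (\<Sum>k. ennreal \<bar>f k \<omega>\<bar>) \<partial>M) < \<infinity>"
    by (simp add: less_top[symmetric] top_unique) (metis ennreal_neq_top neq_top_trans)
  then have "AE \<omega> in M. (\<Sum>k. ennreal \<bar>f k \<omega>\<bar>) \<noteq> \<infinity>"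
    by (intro nn_integral_noteq_infinite) auto
  then show ?thesis
  proof eventually_elim
    case (elim \<omega>)
    then have "summable (\<lambda>k. \<bar>f k \<omega>\<bar>)"
      by (intro summable_suminf_not_top) auto
    then show ?case by (rule summable_rabs_cancel)
  qed
qed

text \<open>Fatou's lemma for the squares. A uniform bound on second moments thus passes to a
  pointwise limit, which becomes square integrable, without any convergence in mean square.\<close>

lemma square_integrable_limit:
  fixes f :: "nat \<Rightarrow> 'a \<Rightarrow> real"
  assumes f: "\<And>n. square_integrable M (f n)" and [measurable]: "g \<in> borel_measurable M"
    and lim: "AE \<omega> in M. (\<lambda>n. f n \<omega>) \<longlonglongrightarrow> g \<omega>"
    and B: "\<And>n. (\<integral>\<omega>. (f n \<omega>)\<^sup>2 \<partial>M) \<le> B"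
  shows "square_integrable M g \<and> (\<integral>\<omega>. (g \<omega>)\<^sup>2 \<partial>M) \<le> B"
proof -
  have [measurable]: "f n \<in> borel_measurable M" and f2: "integrable M (\<lambda>\<omega>. (f n \<omega>)\<^sup>2)" for n
    using f[of n] by (auto simp: square_integrable_def)
  have B0: "0 \<le> B"
    using B[of 0] by (rule order_trans[rotated]) simp
  have "(\<integral>\<^sup>+\<omega>. ennreal ((g \<omega>)\<^sup>2) \<partial>M) = (\<integral>\<^sup>+\<omega>. liminf (\<lambda>n. ennreal ((f n \<omega>)\<^sup>2)) \<partial>M)"
  proof (rule nn_integral_cong_AE)
    show "AE \<omega> in M. ennreal ((g \<omega>)\<^sup>2) = liminf (\<lambda>n. ennreal ((f n \<omega>)\<^sup>2))"
      using lim
    proof eventually_elim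
      case (elim \<omega>)
      then have "(\<lambda>n. ennreal ((f n \<omega>)\<^sup>2)) \<longlonglongrightarrow> ennreal ((g \<omega>)\<^sup>2)"
        by (intro tendsto_ennrealI tendsto_power)
      then show ?case
        by (rule lim_imp_Liminf[symmetric, rotated]) simp
    qed
  qed
  also have "\<dots> \<le> liminf (\<lambda>n. \<integral>\<^sup>+\<omega>. ennreal ((f n \<omega>)\<^sup>2) \<partial>M)"
    by (rule nn_integral_liminf) measurable
  also have "\<dots> \<le> liminf (\<lambda>n. ennreal B)"
    by (intro Liminf_mono always_eventually allI)
      (simp add: nn_integral_eq_integral f2 ennreal_leI B)
  also have "\<dots> = ennreal B"
    by (simp add: Liminf_const)
  finally have le: "(\<integral>\<^sup>+\<omega>. ennreal ((g \<omega>)\<^sup>2) \<partial>M) \<le> ennreal B" .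
  have int: "integrable M (\<lambda>\<omega>. (g \<omega>)\<^sup>2)"
  proof (rule integrableI_nonneg)
    show "(\<integral>\<^sup>+\<omega>. ennreal ((g \<omega>)\<^sup>2) \<partial>M) < \<infinity>"
      using le ennreal_less_top[of B] by (simp add: le_less_trans)
  qed auto
  have "ennreal (\<integral>\<omega>. (g \<omega>)\<^sup>2 \<partial>M) \<le> ennreal B"
    using le by (subst nn_integral_eq_integral[symmetric]) (auto simp: int)
  then have "(\<integral>\<omega>. (g \<omega>)\<^sup>2 \<partial>M) \<le> B"
    using B0 by simp
  then show ?thesis
    using int by (simp add: square_integrable_def)
qed

text \<open>The second moment about m exceeds the variance by (E f - m)^2. Hence a bound about any
  convenient centre bounds the variance, and the expectation need not be computed.\<close>

lemma (in prob_space) variance_le_second_moment_about: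
  fixes f :: "'a \<Rightarrow> real"
  assumes "square_integrable M f"
  shows "variance f \<le> expectation (\<lambda>\<omega>. (f \<omega> - m)\<^sup>2)"
proof -
  have f: "integrable M f" "integrable M (\<lambda>\<omega>. (f \<omega>)\<^sup>2)"
    using assms by (auto simp: square_integrable_imp_integrable) (simp add: square_integrable_def)
  have "expectation (\<lambda>\<omega>. (f \<omega> - m)\<^sup>2) = expectation (\<lambda>\<omega>. (f \<omega>)\<^sup>2) - 2 * m * expectation f + m\<^sup>2"
    using f by (simp add: power2_diff prob_space ac_simps)
  moreover have "0 \<le> (expectation f - m)\<^sup>2" by simp
  ultimately show ?thesis
    using variance_eq[OF f] by (simp add: power2_diff ac_simps)
qed

lemma summable_of_nat_mult_power:
  fixes c :: real
  assumes "\<bar>c\<bar> < 1"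
  shows "summable (\<lambda>k. of_nat k * c ^ k)"
proof -
  \<comment> \<open>The derivative of the geometric series minus the geometric series
    itself.\<close>
  have "summable (\<lambda>k. of_nat (Suc k) * c ^ k - c ^ k)"
    using geometric_deriv_sums[of c] assms
    by (intro summable_diff summable_geometric) (auto simp: sums_iff)
  then show ?thesis by (simp add: algebra_simps)
qed

section \<open>Symmetric noise\<close>

locale symmetric_iid_noise = prob_space M for M :: "'a measure" +
  fixes w :: "nat \<Rightarrow> 'a \<Rightarrow> real^'n" and \<Sigma> :: "real^'n^'n"
  assumes indep: "indep_vars (\<lambda>_. borel) w UNIV"
    and law: "distr M borel (w k) = distr M borel (w 0)"
    and fourth_moment: "integrable M (\<lambda>\<omega>. norm (w 0 \<omega>) ^ 4)"
    and symmetric: "distr M borel (w k) = distr M borel (\<lambda>\<omega>. - w k \<omega>)"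
    and second_moment_noise: "second_moment M (w k) = \<Sigma>"
begin

lemma measurable_noise [measurable]: "w k \<in> borel_measurable M"
  using indep by (auto simp: indep_vars_def)

lemma
  fixes f :: "real^'n \<Rightarrow> real"
  assumes [measurable]: "f \<in> borel_measurable borel"
  shows expectation_noise: "expectation (\<lambda>\<omega>. f (w k \<omega>)) = expectation (\<lambda>\<omega>. f (w 0 \<omega>))"
    and integrable_noise: "integrable M (\<lambda>\<omega>. f (w k \<omega>)) = integrable M (\<lambda>\<omega>. f (w 0 \<omega>))"
proof -
  have "expectation (\<lambda>\<omega>. f (w k \<omega>)) = integral\<^sup>L (distr M borel (w k)) f"
    by (rule integral_distr[symmetric]) auto
  also have "\<dots> = integral\<^sup>L (distr M borel (w 0)) f"
    using law[of k] by simp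
  also have "\<dots> = expectation (\<lambda>\<omega>. f (w 0 \<omega>))"
    by (rule integral_distr) auto
  finally show "expectation (\<lambda>\<omega>. f (w k \<omega>)) = expectation (\<lambda>\<omega>. f (w 0 \<omega>))" .
  have "integrable M (\<lambda>\<omega>. f (w k \<omega>)) = integrable (distr M borel (w k)) f"
    by (rule integrable_distr_eq[symmetric]) auto
  also have "\<dots> = integrable (distr M borel (w 0)) f"
    using law[of k] by simp
  also have "\<dots> = integrable M (\<lambda>\<omega>. f (w 0 \<omega>))"
    by (rule integrable_distr_eq) auto
  finally show "integrable M (\<lambda>\<omega>. f (w k \<omega>)) = integrable M (\<lambda>\<omega>. f (w 0 \<omega>))" .
qed

text \<open>Symmetry of the law identifies the expectation with its own negative. This also covers a
  non-integrable f, where both integrals have the default value 0.\<close>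

lemma expectation_odd:
  fixes f :: "real^'n \<Rightarrow> real"
  assumes [measurable]: "f \<in> borel_measurable borel" and odd: "\<And>v. f (- v) = - f v"
  shows "expectation (\<lambda>\<omega>. f (w k \<omega>)) = 0"
proof -
  have "expectation (\<lambda>\<omega>. f (w k \<omega>)) = integral\<^sup>L (distr M borel (w k)) f"
    by (rule integral_distr[symmetric]) auto
  also have "\<dots> = integral\<^sup>L (distr M borel (\<lambda>\<omega>. - w k \<omega>)) f"
    by (subst symmetric) simp
  also have "\<dots> = expectation (\<lambda>\<omega>. f (- w k \<omega>))"
    by (rule integral_distr) auto
  also have "\<dots> = - expectation (\<lambda>\<omega>. f (w k \<omega>))"
    by (simp add: odd)
  finally show ?thesis by simp
qed

lemma integrable_quartic_bound:
  fixes f :: "real^'n \<Rightarrow> real"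
  assumes [measurable]: "f \<in> borel_measurable borel"
    and le: "\<And>v. \<bar>f v\<bar> \<le> C * (1 + norm v ^ 4)"
  shows "integrable M (\<lambda>\<omega>. f (w k \<omega>))"
  unfolding integrable_noise[OF assms(1), of k]
proof (rule Bochner_Integration.integrable_bound)
  show "integrable M (\<lambda>\<omega>. C * (1 + norm (w 0 \<omega>) ^ 4))"
    using fourth_moment by simp
  show "AE \<omega> in M. norm (f (w 0 \<omega>)) \<le> norm (C * (1 + norm (w 0 \<omega>) ^ 4))"
  proof (rule AE_I2)
    fix \<omega>
    show "norm (f (w 0 \<omega>)) \<le> norm (C * (1 + norm (w 0 \<omega>) ^ 4))"
      using le[of "w 0 \<omega>"] by (metis abs_ge_self order_trans real_norm_def)
  qed
qed simp

lemma square_integrable_noise: "square_integrable M (w k)"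
proof -
  have "r\<^sup>2 \<le> 1 * (1 + r ^ 4)" for r :: real
  proof -
    have "0 \<le> (r\<^sup>2 - 1)\<^sup>2 + r\<^sup>2" by simp
    then show ?thesis by (simp add: power2_diff flip: power_mult)
  qed
  then have "integrable M (\<lambda>\<omega>. (norm (w k \<omega>))\<^sup>2)"
    by (intro integrable_quartic_bound[where C = 1]) auto
  then show ?thesis by (simp add: square_integrable_def)
qed

section \<open>The past of the noise and its independence of the present\<close>

text \<open>The sigma-algebra generated by the first n noise vectors, encoded as a measure so that
  dependence on the past reads \<open>borel_measurable (past n)\<close>; only its space and sets
  matter. The strict bound leaves out \<open>w n\<close>, which is therefore independent of
  it.\<close>

definition past :: "nat \<Rightarrow> 'a measure" where
  "past n = vimage_algebra (space M) (\<lambda>\<omega>. \<lambda>i\<in>{..<n}. w i \<omega>) (PiM {..<n} (\<lambda>_. borel))"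

lemma space_past [simp]: "space (past n) = space M"
  by (simp add: past_def)

lemma sets_past: "sets (past n) =
    {(\<lambda>\<omega>. \<lambda>i\<in>{..<n}. w i \<omega>) -` A \<inter> space M | A. A \<in> sets (PiM {..<n} (\<lambda>_. borel))}"
  unfolding past_def by (rule sets_vimage_algebra2) (auto simp: space_PiM)

lemma measurable_past_imp:
  assumes "f \<in> measurable (past n) N"
  shows "f \<in> measurable M N"
proof -
  have "(\<lambda>\<omega>. \<lambda>i\<in>{..<n}. w i \<omega>) \<in> measurable M (PiM {..<n} (\<lambda>_. borel))"
    by measurable
  then have "sets (past n) \<subseteq> sets M"
    by (auto simp: sets_past intro: measurable_sets)
  with assms show ?thesis
    by (auto simp: measurable_def)
qed

lemma measurable_past_noise:
  assumes "i < n"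
  shows "w i \<in> borel_measurable (past n)"
proof -
  have "(\<lambda>\<omega>. \<lambda>i\<in>{..<n}. w i \<omega>) \<in> measurable (past n) (PiM {..<n} (\<lambda>_. borel))"
    unfolding past_def by (rule measurable_vimage_algebra1) (auto simp: space_PiM)
  then have "(\<lambda>\<omega>. (\<lambda>i\<in>{..<n}. w i \<omega>) i) \<in> borel_measurable (past n)"
    by (rule measurable_compose[OF _ measurable_component_singleton]) (use assms in auto)
  then show ?thesis using assms by simp
qed

text \<open>The blocks of indices below n and {n} are disjoint, so the corresponding restrictions of
  the noise are independent. Events of U are preimages under the first block and events of v(w n)
  under the second.\<close>

lemma indep_var_past:
  fixes U :: "'a \<Rightarrow> real" and v :: "real^'n \<Rightarrow> real"
  assumes U: "U \<in> borel_measurable (past n)" and v [measurable]: "v \<in> borel_measurable borel"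
  shows "indep_var borel U borel (\<lambda>\<omega>. v (w n \<omega>))"
proof -
  \<comment> \<open>Independence of random variables is stated for generated sigma-algebras.
    Intersection stability reduces it to the preimages of Borel sets.\<close>
  have stable: "Int_stable {X -` A \<inter> space M |A. A \<in> sets borel}" for X :: "'a \<Rightarrow> real"
  proof (safe intro!: Int_stableI)
    fix A B :: "real set" assume "A \<in> sets borel" "B \<in> sets borel"
    then show "\<exists>C. (X -` A \<inter> space M) \<inter> (X -` B \<inter> space M) = X -` C \<inter> space M \<and> C \<in> sets borel"
      by (intro exI[of _ "A \<inter> B"]) auto
  qed
  let ?P = "PiM {..<n} (\<lambda>_. borel)" and ?X = "\<lambda>\<omega>. \<lambda>i\<in>{..<n}. w i \<omega>"
  let ?Y = "\<lambda>\<omega>. \<lambda>i\<in>{n}. w i \<omega>"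
  have [measurable]: "U \<in> borel_measurable M"
    using U by (rule measurable_past_imp)
  have ind: "indep_var ?P ?X (PiM {n} (\<lambda>_. borel)) ?Y"
    by (rule indep_var_restrict[OF indep]) auto
  have "indep_set {U -` A \<inter> space M |A. A \<in> sets borel} {(\<lambda>\<omega>. v (w n \<omega>)) -` A \<inter> space M |A. A \<in> sets borel}"
  proof (safe intro!: indep_setI)
    fix A B :: "real set" assume [measurable]: "A \<in> sets borel" "B \<in> sets borel"
    have "U -` A \<inter> space M \<in> sets (past n)"
      using measurable_sets[OF U \<open>A \<in> sets borel\<close>] by simp
    \<comment> \<open>Each event of U is lifted separately to the product space; U itself is never
      written as a function of the past noise.\<close>
    then obtain A' where A': "A' \<in> sets ?P" "U -` A \<inter> space M = ?X -` A' \<inter> space M"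
      by (auto simp: sets_past)
    define B' where "B' = (\<lambda>p. v (p n)) -` B \<inter> space (PiM {n} (\<lambda>_. borel :: (real^'n) measure))"
    have "B' \<in> sets (PiM {n} (\<lambda>_. borel))"
      unfolding B'_def by (rule measurable_sets[where A = borel]) auto
    then have "prob ((\<lambda>\<omega>. (?X \<omega>, ?Y \<omega>)) -` (A' \<times> B') \<inter> space M) =
        prob (?X -` A' \<inter> space M) * prob (?Y -` B' \<inter> space M)"
      by (rule indep_varD[OF ind A'(1)])
    moreover have "(\<lambda>\<omega>. (?X \<omega>, ?Y \<omega>)) -` (A' \<times> B') \<inter> space M =
        (U -` A \<inter> space M) \<inter> ((\<lambda>\<omega>. v (w n \<omega>)) -` B \<inter> space M)"
      unfolding A'(2) by (auto simp: B'_def space_PiM)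
    moreover have "?Y -` B' \<inter> space M = (\<lambda>\<omega>. v (w n \<omega>)) -` B \<inter> space M"
      by (auto simp: B'_def space_PiM)
    ultimately show "prob ((U -` A \<inter> space M) \<inter> ((\<lambda>\<omega>. v (w n \<omega>)) -` B \<inter> space M)) =
        prob (U -` A \<inter> space M) * prob ((\<lambda>\<omega>. v (w n \<omega>)) -` B \<inter> space M)"
      by (simp add: A'(2))
  qed (auto intro: measurable_sets)
  then show ?thesis
    unfolding indep_var_eq by (intro conjI indep_set_sigma_sets stable) auto
qed

lemma has_bochner_integral_past_mult:
  fixes U :: "'a \<Rightarrow> real" and v :: "real^'n \<Rightarrow> real"
  assumes U: "U \<in> borel_measurable (past n)" "integrable M U"
    and v: "v \<in> borel_measurable borel" "integrable M (\<lambda>\<omega>. v (w n \<omega>))"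
  shows "has_bochner_integral M (\<lambda>\<omega>. U \<omega> * v (w n \<omega>)) (expectation U * expectation (\<lambda>\<omega>. v (w n \<omega>)))"
proof -
  have ind: "indep_var borel U borel (\<lambda>\<omega>. v (w n \<omega>))"
    using U(1) v(1) by (rule indep_var_past)
  show ?thesis
    using indep_var_lebesgue_integral[OF ind U(2) v(2)] indep_var_integrable[OF ind U(2) v(2)]
    by (simp add: has_bochner_integral_iff)
qed

text \<open>The cross moments factor by independence, and the noise factor is the expectation of an
  odd function.\<close>

lemma second_moment_add_noise:
  assumes u: "u \<in> borel_measurable (past n)" "square_integrable M u"
  shows "second_moment M (\<lambda>\<omega>. u \<omega> + w n \<omega>) = second_moment M u + \<Sigma>"
proof -
  have [measurable]: "(\<lambda>v::real^'n. v $ i) \<in> borel_measurable borel" for i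
    by simp
  have um: "(\<lambda>\<omega>. u \<omega> $ i) \<in> borel_measurable (past n)" for i
    using u(1) by (rule measurable_compose) simp
  have cross: "has_bochner_integral M (\<lambda>\<omega>. u \<omega> $ i * w n \<omega> $ j) 0" for i j
  proof -
    have "expectation (\<lambda>\<omega>. w n \<omega> $ j) = 0"
      by (rule expectation_odd) auto
    then show ?thesis
      using has_bochner_integral_past_mult[OF um, of i "\<lambda>v. v $ j"]
      by (simp add: square_integrable_imp_integrable square_integrable_nth u square_integrable_noise)
  qed
  have "has_bochner_integral M
      (\<lambda>\<omega>. u \<omega> $ i * u \<omega> $ j + u \<omega> $ i * w n \<omega> $ j + u \<omega> $ j * w n \<omega> $ i + w n \<omega> $ i * w n \<omega> $ j)
      (second_moment M u $ i $ j + 0 + 0 + second_moment M (w n) $ i $ j)" for i j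
    by (intro has_bochner_integral_add has_bochner_integral_second_moment cross u square_integrable_noise)
  then have "has_bochner_integral M (\<lambda>\<omega>. (u \<omega> + w n \<omega>) $ i * (u \<omega> + w n \<omega>) $ j)
      ((second_moment M u + \<Sigma>) $ i $ j)" for i j
    by (simp add: second_moment_noise algebra_simps)
  then show ?thesis
    by (simp add: vec_eq_iff second_moment_def has_bochner_integral_integral_eq)
qed

text \<open>The odd cross terms vanish by symmetry of the noise.\<close>

lemma second_moment_increment:
  fixes T :: "'a \<Rightarrow> real" and a :: "'a \<Rightarrow> real^'n" and q :: "real^'n \<Rightarrow> real"
  assumes T: "T \<in> borel_measurable (past n)" "square_integrable M T"
    and a: "a \<in> borel_measurable (past n)" "square_integrable M a"
    and q: "q \<in> borel_measurable borel" "\<And>v. q (- v) = q v"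
      "square_integrable M (\<lambda>\<omega>. q (w n \<omega>))" "expectation (\<lambda>\<omega>. q (w n \<omega>)) = 0"
  shows "has_bochner_integral M (\<lambda>\<omega>. (T \<omega> + (a \<omega> \<bullet> w n \<omega> + q (w n \<omega>)))\<^sup>2)
    (expectation (\<lambda>\<omega>. (T \<omega>)\<^sup>2) + trace (second_moment M a ** transpose \<Sigma>)
      + expectation (\<lambda>\<omega>. (q (w n \<omega>))\<^sup>2))"
proof -
  note [measurable] = q(1)
  note sq = square_integrable_nth[OF a(2)] square_integrable_nth[OF square_integrable_noise] T(2) q(3)
  have am: "(\<lambda>\<omega>. a \<omega> $ i) \<in> borel_measurable (past n)" for i
    using a(1) by (rule measurable_compose) simp
  note [measurable] = am T(1)
  have 1: "has_bochner_integral M (\<lambda>\<omega>. (T \<omega>)\<^sup>2) (expectation (\<lambda>\<omega>. (T \<omega>)\<^sup>2))"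
    using T(2) by (intro has_bochner_integral_integrable) (simp add: square_integrable_def)
  have 2: "has_bochner_integral M (\<lambda>\<omega>. (q (w n \<omega>))\<^sup>2) (expectation (\<lambda>\<omega>. (q (w n \<omega>))\<^sup>2))"
    using q(3) by (intro has_bochner_integral_integrable) (simp add: square_integrable_def)
  have 3: "has_bochner_integral M (\<lambda>\<omega>. (a \<omega> $ i * a \<omega> $ j) * (w n \<omega> $ i * w n \<omega> $ j))
      (second_moment M a $ i $ j * \<Sigma> $ i $ j)" for i j
  proof -
    have "has_bochner_integral M (\<lambda>\<omega>. (a \<omega> $ i * a \<omega> $ j) * (\<lambda>v. v $ i * v $ j) (w n \<omega>))
      (expectation (\<lambda>\<omega>. a \<omega> $ i * a \<omega> $ j) * expectation (\<lambda>\<omega>. (\<lambda>v. v $ i * v $ j) (w n \<omega>)))"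
      by (rule has_bochner_integral_past_mult) (auto intro!: square_integrable_mult sq)
    then show ?thesis
      by (simp add: second_moment_def flip: second_moment_noise[of n])
  qed
  have 4: "has_bochner_integral M (\<lambda>\<omega>. (T \<omega> * a \<omega> $ i) * w n \<omega> $ i) 0" for i
  proof -
    have "has_bochner_integral M (\<lambda>\<omega>. (T \<omega> * a \<omega> $ i) * (\<lambda>v. v $ i) (w n \<omega>))
      (expectation (\<lambda>\<omega>. T \<omega> * a \<omega> $ i) * expectation (\<lambda>\<omega>. (\<lambda>v. v $ i) (w n \<omega>)))"
      by (rule has_bochner_integral_past_mult)
        (simp_all add: square_integrable_mult[OF sq(3,1)] square_integrable_imp_integrable[OF sq(2)])
    moreover have "expectation (\<lambda>\<omega>. (\<lambda>v. v $ i) (w n \<omega>)) = 0"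
      by (rule expectation_odd) auto
    ultimately show ?thesis by simp
  qed
  have 5: "has_bochner_integral M (\<lambda>\<omega>. T \<omega> * q (w n \<omega>)) 0"
    using has_bochner_integral_past_mult[of T n q] T q
    by (simp add: square_integrable_imp_integrable)
  \<comment> \<open>Here the two parts of one increment are decoupled: v_i q(v) is odd because q is
    even. This is a use of symmetry beyond zero mean, since third moments of the noise are
    involved.\<close>
  have 6: "has_bochner_integral M (\<lambda>\<omega>. a \<omega> $ i * (w n \<omega> $ i * q (w n \<omega>))) 0" for i
  proof -
    have "has_bochner_integral M (\<lambda>\<omega>. a \<omega> $ i * (\<lambda>v. v $ i * q v) (w n \<omega>))
      (expectation (\<lambda>\<omega>. a \<omega> $ i) * expectation (\<lambda>\<omega>. (\<lambda>v. v $ i * q v) (w n \<omega>)))"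
      by (rule has_bochner_integral_past_mult)
        (simp_all add: square_integrable_mult[OF sq(2,4)] square_integrable_imp_integrable[OF sq(1)])
    moreover have "expectation (\<lambda>\<omega>. (\<lambda>v. v $ i * q v) (w n \<omega>)) = 0"
      by (rule expectation_odd) (auto simp: q(2))
    ultimately show ?thesis by simp
  qed
  \<comment> \<open>The expanded square, with inner products written in coordinates so that each
    summand is a past factor times a function of \<open>w n\<close>.\<close>
  have "has_bochner_integral M
    (\<lambda>\<omega>. (T \<omega>)\<^sup>2 + (\<Sum>i\<in>UNIV. \<Sum>j\<in>UNIV. (a \<omega> $ i * a \<omega> $ j) * (w n \<omega> $ i * w n \<omega> $ j))
      + (q (w n \<omega>))\<^sup>2 + 2 * (\<Sum>i\<in>UNIV. (T \<omega> * a \<omega> $ i) * w n \<omega> $ i)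
      + 2 * (T \<omega> * q (w n \<omega>)) + 2 * (\<Sum>i\<in>UNIV. a \<omega> $ i * (w n \<omega> $ i * q (w n \<omega>))))
    (expectation (\<lambda>\<omega>. (T \<omega>)\<^sup>2) + (\<Sum>i\<in>UNIV. \<Sum>j\<in>UNIV. second_moment M a $ i $ j * \<Sigma> $ i $ j)
      + expectation (\<lambda>\<omega>. (q (w n \<omega>))\<^sup>2) + 2 * (\<Sum>i\<in>(UNIV::'n set). 0) + 2 * 0 + 2 * (\<Sum>i\<in>(UNIV::'n set). 0))"
    by (intro has_bochner_integral_add has_bochner_integral_sum has_bochner_integral_mult_right 1 2 3 4 5 6)
  moreover have "(T \<omega>)\<^sup>2 + (\<Sum>i\<in>UNIV. \<Sum>j\<in>UNIV. (a \<omega> $ i * a \<omega> $ j) * (w n \<omega> $ i * w n \<omega> $ j))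
      + (q (w n \<omega>))\<^sup>2 + 2 * (\<Sum>i\<in>UNIV. (T \<omega> * a \<omega> $ i) * w n \<omega> $ i)
      + 2 * (T \<omega> * q (w n \<omega>)) + 2 * (\<Sum>i\<in>UNIV. a \<omega> $ i * (w n \<omega> $ i * q (w n \<omega>)))
      = (T \<omega> + (a \<omega> \<bullet> w n \<omega> + q (w n \<omega>)))\<^sup>2" for \<omega>
  proof -
    have A: "(\<Sum>i\<in>UNIV. \<Sum>j\<in>UNIV. (a \<omega> $ i * a \<omega> $ j) * (w n \<omega> $ i * w n \<omega> $ j)) = (a \<omega> \<bullet> w n \<omega>)\<^sup>2"
      by (simp add: inner_vec_def power2_eq_square sum_product ac_simps)
    have B: "(\<Sum>i\<in>UNIV. (T \<omega> * a \<omega> $ i) * w n \<omega> $ i) = T \<omega> * (a \<omega> \<bullet> w n \<omega>)"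
      by (simp add: inner_vec_def sum_distrib_left ac_simps)
    have C: "(\<Sum>i\<in>UNIV. a \<omega> $ i * (w n \<omega> $ i * q (w n \<omega>))) = (a \<omega> \<bullet> w n \<omega>) * q (w n \<omega>)"
      by (simp add: inner_vec_def sum_distrib_right mult.assoc)
    show ?thesis
      unfolding A B C by (simp add: power2_eq_square algebra_simps)
  qed
  moreover have "(\<Sum>i\<in>UNIV. \<Sum>j\<in>UNIV. second_moment M a $ i $ j * \<Sigma> $ i $ j)
      = trace (second_moment M a ** transpose \<Sigma>)"
    by (simp add: trace_def matrix_matrix_mult_def transpose_def)
  ultimately show ?thesis by simp
qed

end

section \<open>Discounted matrix equations\<close>

lemma inner_matrix_vector_mult: "u \<bullet> ((A :: real^'n^'m) *v v) = (transpose A *v u) \<bullet> v"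
  by (simp add: dot_lmul_matrix transpose_matrix_vector)

lemma inner_transpose_vector_mult: "u \<bullet> (transpose (A :: real^'n^'m) *v v) = (A *v u) \<bullet> v"
  by (subst inner_matrix_vector_mult) (simp only: transpose_transpose)

lemma borel_measurable_matrix_vector_mult [measurable]:
  fixes A :: "real^'n^'m"
  assumes "f \<in> borel_measurable N"
  shows "(\<lambda>\<omega>. A *v f \<omega>) \<in> borel_measurable N"
  using matrix_vector_mult_linear_continuous_on assms by (rule borel_measurable_continuous_on)

lemma norm_matrix_vector_mult_le: "norm ((A :: real^'n^'m) *v v) \<le> onorm ((*v) A) * norm v"
  by (rule onorm) simp

lemma quadratic_form_bound:
  fixes A :: "real^'n^'n"
  shows "\<bar>v \<bullet> (A *v v)\<bar> \<le> onorm ((*v) A) * (norm v)\<^sup>2"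
proof -
  have "\<bar>v \<bullet> (A *v v)\<bar> \<le> norm v * norm (A *v v)"
    by (rule Cauchy_Schwarz_ineq2)
  also have "\<dots> \<le> norm v * (onorm ((*v) A) * norm v)"
    by (intro mult_left_mono norm_matrix_vector_mult_le) simp
  finally show ?thesis by (simp add: power2_eq_square ac_simps)
qed

text \<open>Iterating the equation shows that the bilinear form of D at (u, v) is \<gamma>^k times
  its value at (F^k u, F^k v), which stays bounded. This is uniqueness for the discounted Lyapunov
  equation; applied to P minus its transpose it makes P symmetric.\<close>

lemma discounted_invariant_form_eq_0:
  fixes D F :: "real^'n^'n"
  assumes \<gamma>: "0 \<le> \<gamma>" "\<gamma> < 1"
    and C: "\<And>k v. norm (matpow F k *v v) \<le> C * norm v"
    and D: "D = \<gamma> *\<^sub>R (transpose F ** D ** F)"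
  shows "D = 0"
proof -
  have "u \<bullet> (D *v v) = 0" for u v
  proof -
    have step: "a \<bullet> (D *v b) = \<gamma> * ((F *v a) \<bullet> (D *v (F *v b)))" for a b
      using arg_cong[OF D, of "\<lambda>N. a \<bullet> (N *v b)"]
      by (simp only: scaleR_matrix_vector_assoc[symmetric] matrix_vector_mul_assoc[symmetric]
        inner_transpose_vector_mult inner_scaleR_right)
    have iter: "u \<bullet> (D *v v) = \<gamma> ^ k * ((matpow F k *v u) \<bullet> (D *v (matpow F k *v v)))" for k
    proof (induction k)
      case (Suc k)
      then show ?case
        using step[of "matpow F k *v u" "matpow F k *v v"] by (simp add: matrix_vector_mul_assoc)
    qed simp
    define L where "L = (C * norm u) * (onorm ((*v) D) * (C * norm v))"
    have bound: "\<bar>u \<bullet> (D *v v)\<bar> \<le> \<gamma> ^ k * L" for k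
    proof -
      have "\<bar>(matpow F k *v u) \<bullet> (D *v (matpow F k *v v))\<bar>
          \<le> norm (matpow F k *v u) * norm (D *v (matpow F k *v v))"
        by (rule Cauchy_Schwarz_ineq2)
      also have "\<dots> \<le> L"
        unfolding L_def
      proof (rule mult_mono[OF C])
        have "norm (D *v (matpow F k *v v)) \<le> onorm ((*v) D) * norm (matpow F k *v v)"
          by (rule norm_matrix_vector_mult_le)
        also have "\<dots> \<le> onorm ((*v) D) * (C * norm v)"
          by (intro mult_left_mono C onorm_pos_le) simp
        finally show "norm (D *v (matpow F k *v v)) \<le> onorm ((*v) D) * (C * norm v)" .
        show "0 \<le> C * norm u"
          by (rule order_trans[OF norm_ge_zero C[of 0]])
      qed simp
      finally show ?thesis
        using \<gamma> by (subst iter[of k]) (simp add: abs_mult mult_left_mono)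
    qed
    have "(\<lambda>k. \<gamma> ^ k * L) \<longlonglongrightarrow> 0 * L"
      using \<gamma> by (intro tendsto_mult LIMSEQ_realpow_zero) auto
    then have "\<bar>u \<bullet> (D *v v)\<bar> \<le> 0 * L"
      by (rule LIMSEQ_le_const) (use bound in blast)
    then show ?thesis by simp
  qed
  \<comment> \<open>With u = D v the vanishing form gives |D v|^2 = 0.\<close>
  from this[of "D *v v" v for v] show ?thesis
    by (subst matrix_eq) simp
qed

text \<open>Iterating the inequality along y_k, the k-th image of u under the transpose of F, bounds
  the form at u from below by \<gamma>^k times its value at y_k. As the y_k stay bounded, this lower
  bound tends to 0. It is applied to Z with the discount \<gamma>^2.\<close>

lemma discounted_superinvariant_form_nonneg:
  fixes Z F :: "real^'n^'n"
  assumes \<gamma>: "0 \<le> \<gamma>" "\<gamma> < 1"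
    and C: "\<And>k v. norm (matpow F k *v v) \<le> C * norm v"
    and Z: "\<And>u. \<gamma> * ((transpose F *v u) \<bullet> (Z *v (transpose F *v u))) \<le> u \<bullet> (Z *v u)"
  shows "0 \<le> u \<bullet> (Z *v u)"
proof -
  define y where "y k = ((*v) (transpose F) ^^ k) u" for k
  have iter: "\<gamma> ^ k * (y k \<bullet> (Z *v y k)) \<le> u \<bullet> (Z *v u)" for k
  proof (induction k)
    case (Suc k)
    have "\<gamma> ^ k * (\<gamma> * (y (Suc k) \<bullet> (Z *v y (Suc k)))) \<le> \<gamma> ^ k * (y k \<bullet> (Z *v y k))"
      using Z[of "y k"] \<gamma> by (intro mult_left_mono) (auto simp: y_def)
    with Suc show ?case by (simp add: ac_simps)
  qed (simp add: y_def)
  \<comment> \<open>The power bound is known for F only; the adjoint relation transfers it to the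
    transpose.\<close>
  have dual: "y k \<bullet> v = u \<bullet> (matpow F k *v v)" for k and v :: "real^'n"
  proof (induction k arbitrary: v)
    case (Suc k)
    have "y (Suc k) \<bullet> v = y k \<bullet> (F *v v)"
      by (simp add: y_def inner_matrix_vector_mult)
    also have "\<dots> = u \<bullet> (matpow F k *v (F *v v))" by (rule Suc)
    also have "matpow F k *v (F *v v) = matpow F (Suc k) *v v"
      by (induction k) (simp_all flip: matrix_vector_mul_assoc)
    finally show ?case .
  qed (simp add: y_def)
  have C0: "0 \<le> C * norm v" for v :: "real^'n"
    by (rule order_trans[OF norm_ge_zero C[of 0]])
  have y: "norm (y k) \<le> C * norm u" for k
  proof (cases "y k = 0")
    case False
    \<comment> \<open>The dual relation tested at \<open>y k\<close> itself, after which one factor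
      |y_k| cancels.\<close>
    have "norm (y k) * norm (y k) = u \<bullet> (matpow F k *v y k)"
      by (simp add: dual[symmetric] power2_norm_eq_inner flip: power2_eq_square)
    also have "\<dots> \<le> norm u * norm (matpow F k *v y k)"
      by (rule norm_cauchy_schwarz)
    also have "\<dots> \<le> norm u * (C * norm (y k))"
      by (intro mult_left_mono C) simp
    finally show ?thesis using False by (simp add: ac_simps)
  qed (simp add: C0)
  define L where "L = onorm ((*v) Z) * (C * norm u)\<^sup>2"
  have "- (\<gamma> ^ k * L) \<le> u \<bullet> (Z *v u)" for k
  proof -
    have "\<bar>y k \<bullet> (Z *v y k)\<bar> \<le> onorm ((*v) Z) * (norm (y k))\<^sup>2"
      by (rule quadratic_form_bound)
    also have "\<dots> \<le> L"
      unfolding L_def by (intro mult_left_mono power_mono y onorm_pos_le) auto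
    finally have "\<gamma> ^ k * - L \<le> \<gamma> ^ k * (y k \<bullet> (Z *v y k))"
      using \<gamma> by (intro mult_left_mono) auto
    with iter[of k] show ?thesis by simp
  qed
  moreover have "(\<lambda>k. - (\<gamma> ^ k * L)) \<longlonglongrightarrow> - (0 * L)"
    using \<gamma> by (intro tendsto_minus tendsto_mult LIMSEQ_realpow_zero) auto
  ultimately have "- (0 * L) \<le> u \<bullet> (Z *v u)"
    by (intro LIMSEQ_le_const2) auto
  then show ?thesis by simp
qed

lemma second_moment_symmetric: "transpose (second_moment M u) = second_moment M u"
  by (simp add: second_moment_def transpose_def mult.commute vec_eq_iff)

lemma second_moment_scaleR: "second_moment M (\<lambda>\<omega>. c *\<^sub>R u \<omega>) = c\<^sup>2 *\<^sub>R second_moment M u"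
proof -
  have "second_moment M (\<lambda>\<omega>. c *\<^sub>R u \<omega>) $ i $ j = (\<integral>\<omega>. c\<^sup>2 * (u \<omega> $ i * u \<omega> $ j) \<partial>M)" for i j
    unfolding second_moment_def by (simp add: power2_eq_square ac_simps)
  then show ?thesis
    by (simp add: second_moment_def vec_eq_iff)
qed

lemma trace_scaleR: "trace (c *\<^sub>R A) = c * trace (A :: real^'n^'n)"
  by (simp add: trace_def sum_distrib_left)

section \<open>The closed loop\<close>

text \<open>Stability is recorded as the power bound that \<open>matpow_bounded\<close> extracts
  from the spectral radius.\<close>

locale closed_loop = symmetric_iid_noise M w \<Sigma>
  for M :: "'a measure" and w :: "nat \<Rightarrow> 'a \<Rightarrow> real^'n" and \<Sigma> +
  fixes F P :: "real^'n^'n" and x :: "real^'n" and \<gamma> C :: real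
  assumes discount: "0 < \<gamma>" "\<gamma> < 1"
    and P_symmetric: "transpose P = P"
    and stable: "\<And>k v. norm (matpow F k *v v) \<le> C * norm v"
begin

text \<open>The image \<open>F x\<^sub>n\<close> of the state at time \<open>n\<close>, not the state itself.\<close>

primrec drift :: "nat \<Rightarrow> 'a \<Rightarrow> real^'n" where
  "drift 0 = (\<lambda>\<omega>. F *v x)"
| "drift (Suc n) = (\<lambda>\<omega>. F *v (drift n \<omega> + w n \<omega>))"

text \<open>The two summands are the vectors paired with \<open>w n\<close> in the linear and the
  bilinear series of the return, so those series merge into one with terms w_n . P drift_n.\<close>

lemma drift_eq: "drift n \<omega> = matpow F (Suc n) *v x + (\<Sum>\<tau><n. matpow F (n - \<tau>) *v w \<tau> \<omega>)"
proof (induction n)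
  case (Suc n)
  have "(\<Sum>\<tau><Suc n. matpow F (Suc n - \<tau>) *v w \<tau> \<omega>) = F *v ((\<Sum>\<tau><n. matpow F (n - \<tau>) *v w \<tau> \<omega>) + w n \<omega>)"
    by (simp add: matrix_vector_right_distrib linear_sum[OF matrix_vector_mul_linear] Suc_diff_le matrix_vector_mul_assoc)
  then show ?case
    by (simp add: Suc matrix_vector_right_distrib matrix_vector_mul_assoc)
qed simp

lemma measurable_drift: "n \<le> m \<Longrightarrow> drift n \<in> borel_measurable (past m)"
proof (induction n)
  case (Suc n)
  then have [measurable]: "drift n \<in> borel_measurable (past m)" "w n \<in> borel_measurable (past m)"
    by (auto intro: measurable_past_noise)
  show ?case by simp
qed simp

lemma square_integrable_drift: "square_integrable M (drift n)"
  by (induction n) (auto intro!: square_integrable_const square_integrable_matrix_vector_mult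
    square_integrable_add square_integrable_noise)

lemma second_moment_drift_Suc:
  "second_moment M (drift (Suc n)) = F ** (second_moment M (drift n) + \<Sigma>) ** transpose F"
  by (simp add: second_moment_matrix_vector_mult square_integrable_add square_integrable_drift
    square_integrable_noise second_moment_add_noise measurable_drift)

definition q :: "real^'n \<Rightarrow> real" where
  "q v = v \<bullet> (P *v v) - trace (P ** \<Sigma>)"

lemma measurable_q [measurable]: "q \<in> borel_measurable borel"
  unfolding q_def by measurable

lemma has_bochner_integral_cost: "has_bochner_integral M (\<lambda>\<omega>. w n \<omega> \<bullet> (P *v w n \<omega>)) (trace (P ** \<Sigma>))"
  using has_bochner_integral_quadratic_form[OF square_integrable_noise, of n P]
  by (simp add: second_moment_noise)

lemma expectation_q: "expectation (\<lambda>\<omega>. q (w n \<omega>)) = 0"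
  using has_bochner_integral_cost[of n] by (simp add: q_def has_bochner_integral_iff prob_space)

lemma cost_square_le: "(v \<bullet> (P *v v))\<^sup>2 \<le> (onorm ((*v) P))\<^sup>2 * norm v ^ 4"
proof -
  have "\<bar>v \<bullet> (P *v v)\<bar>\<^sup>2 \<le> (onorm ((*v) P) * (norm v)\<^sup>2)\<^sup>2"
    by (intro power_mono quadratic_form_bound) simp
  then show ?thesis by (simp add: power_mult_distrib flip: power_mult)
qed

lemma square_integrable_cost: "square_integrable M (\<lambda>\<omega>. w n \<omega> \<bullet> (P *v w n \<omega>))"
proof -
  have "integrable M (\<lambda>\<omega>. (w n \<omega> \<bullet> (P *v w n \<omega>))\<^sup>2)"
  proof (rule integrable_quartic_bound[where C = "(onorm ((*v) P))\<^sup>2"])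
    show "\<bar>(v \<bullet> (P *v v))\<^sup>2\<bar> \<le> (onorm ((*v) P))\<^sup>2 * (1 + norm v ^ 4)" for v
      using cost_square_le[of v] by (simp add: distrib_left add_increasing)
  qed simp
  then show ?thesis by (simp add: square_integrable_def)
qed

lemma square_integrable_q: "square_integrable M (\<lambda>\<omega>. q (w n \<omega>))"
  using square_integrable_add[OF square_integrable_cost square_integrable_const, of n "- trace (P ** \<Sigma>)"]
  by (simp add: q_def)

text \<open>The left side is the variance of the cost w . P w, whose mean is tr(P \<Sigma>) and
  whose square is at most |P|^2 |w|^4.\<close>

lemma expectation_q_square_le:
  "expectation (\<lambda>\<omega>. (q (w 0 \<omega>))\<^sup>2)
    \<le> (onorm ((*v) P))\<^sup>2 * expectation (\<lambda>\<omega>. norm (w 0 \<omega>) ^ 4) - (trace (P ** \<Sigma>))\<^sup>2"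
proof -
  let ?c = "\<lambda>\<omega>. w 0 \<omega> \<bullet> (P *v w 0 \<omega>)" and ?t = "trace (P ** \<Sigma>)"
  have c2: "integrable M (\<lambda>\<omega>. (?c \<omega>)\<^sup>2)"
    using square_integrable_cost[of 0] by (simp add: square_integrable_def)
  have "variance ?c = expectation (\<lambda>\<omega>. (?c \<omega>)\<^sup>2) - (expectation ?c)\<^sup>2"
    by (rule variance_eq) (use square_integrable_cost[of 0] c2 in \<open>auto intro: square_integrable_imp_integrable\<close>)
  then have "expectation (\<lambda>\<omega>. (q (w 0 \<omega>))\<^sup>2) = expectation (\<lambda>\<omega>. (?c \<omega>)\<^sup>2) - ?t\<^sup>2"
    using has_bochner_integral_cost[of 0] by (simp add: q_def has_bochner_integral_iff)
  moreover have "expectation (\<lambda>\<omega>. (?c \<omega>)\<^sup>2) \<le> expectation (\<lambda>\<omega>. (onorm ((*v) P))\<^sup>2 * norm (w 0 \<omega>) ^ 4)"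
    by (rule integral_mono[OF c2]) (auto simp: fourth_moment cost_square_le)
  ultimately show ?thesis by simp
qed

definition fluctuation :: "nat \<Rightarrow> 'a \<Rightarrow> real" where
  "fluctuation n \<omega> = (\<Sum>k<n. \<gamma> ^ Suc k * (2 * (w k \<omega> \<bullet> (P *v drift k \<omega>)) + q (w k \<omega>)))"

text \<open>The discount enters squared because orthogonal terms with weights \<gamma>^k contribute
  their second moments; the common factor \<gamma>^2 is kept outside.\<close>

definition gramian :: "nat \<Rightarrow> real^'n^'n" where
  "gramian n = (\<Sum>k<n. (\<gamma>\<^sup>2) ^ k *\<^sub>R second_moment M (drift k))"

lemma measurable_fluctuation: "fluctuation n \<in> borel_measurable (past n)"
proof -
  have [measurable]: "drift k \<in> borel_measurable (past n)" "w k \<in> borel_measurable (past n)" if "k < n" for k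
    using that by (auto intro: measurable_past_noise measurable_drift)
  show ?thesis unfolding fluctuation_def by measurable
qed

text \<open>The increment formula is applied n times. Square integrability is carried along in the
  same induction because that formula requires it of the preceding partial sum.\<close>

lemma fluctuation_second_moment:
  "square_integrable M (fluctuation n) \<and>
    expectation (\<lambda>\<omega>. (fluctuation n \<omega>)\<^sup>2) = 4 * \<gamma>\<^sup>2 * trace (P ** \<Sigma> ** P ** gramian n)
      + \<gamma>\<^sup>2 * (\<Sum>k<n. (\<gamma>\<^sup>2) ^ k) * expectation (\<lambda>\<omega>. (q (w 0 \<omega>))\<^sup>2)"
proof (induction n)
  case 0
  then show ?case
    by (simp add: fluctuation_def[abs_def] gramian_def square_integrable_const trace_def)
next
  case (Suc n)
  \<comment> \<open>The coefficient of \<open>w n\<close> in the new term. Its scalar squares to 4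
    \<gamma>^2 (\<gamma>^2)^n, the source of the factor 4 \<gamma>^2.\<close>
  define a where "a = (\<lambda>\<omega>. (2 * \<gamma> ^ Suc n) *\<^sub>R (P *v drift n \<omega>))"
  let ?S = "second_moment M (drift n)"
  have [measurable]: "drift n \<in> borel_measurable (past n)"
    by (simp add: measurable_drift)
  have "square_integrable M a"
    unfolding a_def by (intro square_integrable_bounded_linear[OF _ bounded_linear_scaleR_right]
      square_integrable_matrix_vector_mult square_integrable_drift)
  moreover have "a \<in> borel_measurable (past n)"
    unfolding a_def by measurable
  moreover have "square_integrable M (\<lambda>\<omega>. \<gamma> ^ Suc n * q (w n \<omega>))"
    by (rule square_integrable_bounded_linear[OF square_integrable_q bounded_linear_mult_right])
  moreover have "q (- v) = q v" for v
    by (simp add: q_def linear_neg[OF matrix_vector_mul_linear])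
  ultimately have step: "has_bochner_integral M
      (\<lambda>\<omega>. (fluctuation n \<omega> + (a \<omega> \<bullet> w n \<omega> + \<gamma> ^ Suc n * q (w n \<omega>)))\<^sup>2)
      (expectation (\<lambda>\<omega>. (fluctuation n \<omega>)\<^sup>2) + trace (second_moment M a ** transpose \<Sigma>)
        + expectation (\<lambda>\<omega>. (\<gamma> ^ Suc n * q (w n \<omega>))\<^sup>2))"
    using Suc by (intro second_moment_increment[where q = "\<lambda>v. \<gamma> ^ Suc n * q v"])
      (auto simp: measurable_fluctuation expectation_q)
  have fl: "fluctuation n \<omega> + (a \<omega> \<bullet> w n \<omega> + \<gamma> ^ Suc n * q (w n \<omega>)) = fluctuation (Suc n) \<omega>" for \<omega>
    by (simp add: fluctuation_def a_def algebra_simps inner_commute)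
  have "trace (second_moment M a ** transpose \<Sigma>)
      = (2 * \<gamma> ^ Suc n)\<^sup>2 * trace (P ** ?S ** transpose P ** transpose \<Sigma>)"
    by (simp add: a_def second_moment_scaleR second_moment_matrix_vector_mult square_integrable_drift
      trace_scaleR flip: scalar_matrix_assoc)
  \<comment> \<open>\<Sigma> is symmetric because it is a second moment matrix; cyclicity of the
    trace then moves P \<Sigma> to the front.\<close>
  also have "trace (P ** ?S ** transpose P ** transpose \<Sigma>) = trace ((P ** ?S) ** (P ** \<Sigma>))"
    using second_moment_symmetric[of M "w 0"] by (simp add: P_symmetric second_moment_noise matrix_mul_assoc)
  also have "\<dots> = trace (P ** \<Sigma> ** P ** ?S)"
    by (subst trace_mul_sym) (simp add: matrix_mul_assoc)
  finally have tr: "trace (second_moment M a ** transpose \<Sigma>)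
      = 4 * \<gamma>\<^sup>2 * ((\<gamma>\<^sup>2) ^ n * trace (P ** \<Sigma> ** P ** ?S))"
    by (simp add: power_mult_distrib power2_eq_square)
  have gr: "trace (P ** \<Sigma> ** P ** gramian (Suc n))
      = trace (P ** \<Sigma> ** P ** gramian n) + (\<gamma>\<^sup>2) ^ n * trace (P ** \<Sigma> ** P ** ?S)"
    by (simp add: gramian_def matrix_add_ldistrib trace_add trace_scaleR matrix_scalar_ac
      flip: scalar_matrix_assoc)
  have qn: "expectation (\<lambda>\<omega>. (\<gamma> ^ Suc n * q (w n \<omega>))\<^sup>2)
      = \<gamma>\<^sup>2 * (\<gamma>\<^sup>2) ^ n * expectation (\<lambda>\<omega>. (q (w 0 \<omega>))\<^sup>2)"
  proof -
    have "(\<gamma> ^ Suc n)\<^sup>2 = \<gamma>\<^sup>2 * (\<gamma>\<^sup>2) ^ n"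
      by (simp add: power_mult_distrib power2_eq_square)
    then show ?thesis
      using expectation_noise[of "\<lambda>v. (q v)\<^sup>2" n] by (simp only: power_mult_distrib integral_mult_right_zero) simp
  qed
  have "expectation (\<lambda>\<omega>. (fluctuation (Suc n) \<omega>)\<^sup>2) = 4 * \<gamma>\<^sup>2 * trace (P ** \<Sigma> ** P ** gramian (Suc n))
      + \<gamma>\<^sup>2 * (\<Sum>k<Suc n. (\<gamma>\<^sup>2) ^ k) * expectation (\<lambda>\<omega>. (q (w 0 \<omega>))\<^sup>2)"
    using has_bochner_integral_integral_eq[OF step] Suc unfolding fl tr gr qn
    by (simp add: algebra_simps)
  moreover have "square_integrable M (fluctuation (Suc n))"
    using step measurable_past_imp[OF measurable_fluctuation, of "Suc n"] unfolding fl
    by (simp add: square_integrable_def has_bochner_integral_iff)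
  ultimately show ?case by blast
qed

section \<open>Comparison of the discounted second moments with Z\<close>

text \<open>Z is a fixed point of X = \<gamma>^2 F X F^T + F (x x^T + c \<Sigma>) F^T with c =
  \<gamma>^2 / (1 - \<gamma>^2), and the gramians obey the same recursion with a partial geometric
  sum in place of c. Induction compares the quadratic forms, starting from 0 <= Z.\<close>

lemma gramian_le:
  assumes \<Sigma>: "\<And>u. 0 \<le> u \<bullet> (\<Sigma> *v u)"
    and Z: "Z - \<gamma>\<^sup>2 *\<^sub>R (F ** Z ** transpose F) =
      F ** (outer_prod x x + (\<gamma>\<^sup>2 / (1 - \<gamma>\<^sup>2)) *\<^sub>R \<Sigma>) ** transpose F"
  shows "u \<bullet> (gramian n *v u) \<le> u \<bullet> (Z *v u)"
proof -
  define Q where "Q N u = u \<bullet> (N *v u)" for N :: "real^'n^'n" and u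
  have Q_add: "Q (N + N') u = Q N u + Q N' u" for N N' u
    by (simp add: Q_def matrix_vector_mult_add_rdistrib inner_add_right)
  have Q_diff: "Q (N - N') u = Q N u - Q N' u" for N N' u
    by (simp add: Q_def matrix_vector_mult_diff_rdistrib inner_diff_right)
  have Q_scaleR: "Q (c *\<^sub>R N) u = c * Q N u" for c N u
    by (simp add: Q_def flip: scaleR_matrix_vector_assoc)
  have Q_0: "Q 0 u = 0" for u by (simp add: Q_def)
  have Q_sum: "Q (\<Sum>k<n. N k) u = (\<Sum>k<n. Q (N k) u)" for N and n :: nat and u
    by (induction n) (simp_all add: Q_add Q_0)
  have Q_conj: "Q (F ** N ** transpose F) u = Q N (transpose F *v u)" for N u
    by (simp add: Q_def inner_matrix_vector_mult flip: matrix_vector_mul_assoc)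
  have Q_outer: "Q (outer_prod v v) u = (u \<bullet> v)\<^sup>2" for u v
    by (simp add: Q_def outer_prod_def inner_vec_def matrix_vector_mult_def power2_eq_square
      sum_product sum_distrib_left ac_simps)
  have g1: "\<gamma>\<^sup>2 < 1" "0 \<le> \<gamma>\<^sup>2"
    using discount by (auto simp: power_less_one_iff)
  have QZ: "Q Z u = \<gamma>\<^sup>2 * Q Z (transpose F *v u) + Q (outer_prod x x) (transpose F *v u)
      + \<gamma>\<^sup>2 / (1 - \<gamma>\<^sup>2) * Q \<Sigma> (transpose F *v u)" for u
    using arg_cong[OF Z, of "\<lambda>N. Q N u"]
    by (simp only: Q_add Q_diff Q_scaleR Q_conj)
  have \<Sigma>': "0 \<le> Q \<Sigma> u" for u using \<Sigma> by (simp add: Q_def)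
  have Z0: "0 \<le> Q Z u" for u
    unfolding Q_def
  proof (rule discounted_superinvariant_form_nonneg[OF g1(2,1) stable])
    fix u
    have "0 \<le> Q (outer_prod x x) (transpose F *v u)" by (simp add: Q_outer)
    moreover have "0 \<le> \<gamma>\<^sup>2 / (1 - \<gamma>\<^sup>2) * Q \<Sigma> (transpose F *v u)"
      using g1 \<Sigma>' by (intro mult_nonneg_nonneg divide_nonneg_nonneg) auto
    ultimately have "\<gamma>\<^sup>2 * Q Z (transpose F *v u) \<le> Q Z u"
      by (simp add: QZ[of u])
    then show "\<gamma>\<^sup>2 * ((transpose F *v u) \<bullet> (Z *v (transpose F *v u))) \<le> u \<bullet> (Z *v u)"
      by (simp add: Q_def)
  qed
  \<comment> \<open>The total weight with which \<Sigma> has entered after n steps; \<gamma>^2 times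
    it stays below the weight in the equation for Z.\<close>
  define s where "s n = (\<Sum>k<n. (\<gamma>\<^sup>2) ^ k)" for n :: nat
  have s: "\<gamma>\<^sup>2 * s n \<le> \<gamma>\<^sup>2 / (1 - \<gamma>\<^sup>2)" for n
  proof -
    have "s n \<le> 1 / (1 - \<gamma>\<^sup>2)"
      using g1 by (simp add: s_def sum_gp_strict divide_right_mono)
    then show ?thesis using mult_left_mono[OF _ g1(2)] by fastforce
  qed
  have init: "Q (second_moment M (drift 0)) u = Q (outer_prod x x) (transpose F *v u)" for u
  proof -
    have "second_moment M (drift 0) = outer_prod (F *v x) (F *v x)"
      by (simp add: second_moment_def outer_prod_def prob_space)
    then show ?thesis by (simp add: Q_outer inner_matrix_vector_mult)
  qed
  have QG: "Q (gramian (Suc n)) u = Q (outer_prod x x) (transpose F *v u)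
      + \<gamma>\<^sup>2 * Q (gramian n) (transpose F *v u) + \<gamma>\<^sup>2 * s n * Q \<Sigma> (transpose F *v u)" for n u
  proof -
    \<comment> \<open>Splitting off time 0 leaves second moments at shifted times, to which the
      recursion of the drift applies.\<close>
    have "Q (gramian (Suc n)) u = Q (second_moment M (drift 0)) u
        + (\<Sum>k<n. (\<gamma>\<^sup>2) ^ Suc k * Q (second_moment M (drift (Suc k))) u)"
      unfolding gramian_def sum.lessThan_Suc_shift Q_add Q_sum Q_scaleR by simp
    also have "\<dots> = Q (outer_prod x x) (transpose F *v u) + (\<Sum>k<n. (\<gamma>\<^sup>2) ^ Suc k *
        (Q (second_moment M (drift k)) (transpose F *v u) + Q \<Sigma> (transpose F *v u)))"
      unfolding init second_moment_drift_Suc Q_conj Q_add ..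
    also have "\<dots> = Q (outer_prod x x) (transpose F *v u)
      + \<gamma>\<^sup>2 * Q (gramian n) (transpose F *v u) + \<gamma>\<^sup>2 * s n * Q \<Sigma> (transpose F *v u)"
      unfolding gramian_def Q_sum Q_scaleR s_def
      by (simp add: algebra_simps sum.distrib sum_distrib_left)
    finally show ?thesis .
  qed
  have "Q (gramian n) u \<le> Q Z u" for u
  proof (induction n arbitrary: u)
    case 0
    then show ?case by (simp add: gramian_def Q_0 Z0)
  next
    case (Suc n)
    have "\<gamma>\<^sup>2 * Q (gramian n) (transpose F *v u) \<le> \<gamma>\<^sup>2 * Q Z (transpose F *v u)"
      by (intro mult_left_mono Suc g1)
    moreover have "\<gamma>\<^sup>2 * s n * Q \<Sigma> (transpose F *v u) \<le> \<gamma>\<^sup>2 / (1 - \<gamma>\<^sup>2) * Q \<Sigma> (transpose F *v u)"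
      by (intro mult_right_mono s \<Sigma>')
    ultimately show ?case unfolding QG QZ[of u] by linarith
  qed
  then show ?thesis by (simp add: Q_def)
qed

text \<open>P \<Sigma> P is the second moment matrix of P w, so the trace is the expectation of a
  nonnegative quadratic form. The noise itself replaces a square root of \<Sigma>.\<close>

lemma trace_weight_nonneg:
  assumes "\<And>u. 0 \<le> u \<bullet> (E *v u)"
  shows "0 \<le> trace (P ** \<Sigma> ** P ** E)"
proof -
  have "has_bochner_integral M (\<lambda>\<omega>. (P *v w 0 \<omega>) \<bullet> (E *v (P *v w 0 \<omega>)))
      (trace (E ** second_moment M (\<lambda>\<omega>. P *v w 0 \<omega>)))"
    by (intro has_bochner_integral_quadratic_form square_integrable_matrix_vector_mult square_integrable_noise)
  moreover have "trace (E ** second_moment M (\<lambda>\<omega>. P *v w 0 \<omega>)) = trace (P ** \<Sigma> ** P ** E)"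
    by (subst trace_mul_sym)
      (simp add: second_moment_matrix_vector_mult square_integrable_noise second_moment_noise P_symmetric)
  ultimately have "trace (P ** \<Sigma> ** P ** E) = expectation (\<lambda>\<omega>. (P *v w 0 \<omega>) \<bullet> (E *v (P *v w 0 \<omega>)))"
    by (simp add: has_bochner_integral_iff)
  also have "\<dots> \<ge> 0"
    by (intro Bochner_Integration.integral_nonneg assms)
  finally show ?thesis .
qed

text \<open>Replaces the gramian by Z and the finite geometric sum by its limit, which gives the
  bound uniform in n that Fatou's lemma requires.\<close>

lemma fluctuation_second_moment_le:
  assumes \<Sigma>: "\<And>u. 0 \<le> u \<bullet> (\<Sigma> *v u)"
    and Z: "Z - \<gamma>\<^sup>2 *\<^sub>R (F ** Z ** transpose F) =
      F ** (outer_prod x x + (\<gamma>\<^sup>2 / (1 - \<gamma>\<^sup>2)) *\<^sub>R \<Sigma>) ** transpose F"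
  shows "expectation (\<lambda>\<omega>. (fluctuation n \<omega>)\<^sup>2) \<le>
      \<gamma>\<^sup>2 / (1 - \<gamma>\<^sup>2) * expectation (\<lambda>\<omega>. (q (w 0 \<omega>))\<^sup>2) + 4 * \<gamma>\<^sup>2 * trace (P ** \<Sigma> ** P ** Z)"
proof -
  have g1: "\<gamma>\<^sup>2 < 1" "0 \<le> \<gamma>\<^sup>2"
    using discount by (auto simp: power_less_one_iff)
  have "0 \<le> trace (P ** \<Sigma> ** P ** (Z - gramian n))"
    using gramian_le[OF assms] by (intro trace_weight_nonneg)
      (simp add: matrix_vector_mult_diff_rdistrib inner_diff_right)
  also have "P ** \<Sigma> ** P ** (Z - gramian n) = P ** \<Sigma> ** P ** Z - P ** \<Sigma> ** P ** gramian n"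
    by (simp add: matrix_matrix_mult_def vec_eq_iff right_diff_distrib sum_subtractf)
  finally have "trace (P ** \<Sigma> ** P ** gramian n) \<le> trace (P ** \<Sigma> ** P ** Z)"
    by (simp add: trace_sub)
  then have "4 * \<gamma>\<^sup>2 * trace (P ** \<Sigma> ** P ** gramian n) \<le> 4 * \<gamma>\<^sup>2 * trace (P ** \<Sigma> ** P ** Z)"
    by (intro mult_left_mono) auto
  moreover have "\<gamma>\<^sup>2 * (\<Sum>k<n. (\<gamma>\<^sup>2) ^ k) * expectation (\<lambda>\<omega>. (q (w 0 \<omega>))\<^sup>2)
      \<le> \<gamma>\<^sup>2 / (1 - \<gamma>\<^sup>2) * expectation (\<lambda>\<omega>. (q (w 0 \<omega>))\<^sup>2)"
  proof (rule mult_right_mono)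
    have "(\<Sum>k<n. (\<gamma>\<^sup>2) ^ k) \<le> 1 / (1 - \<gamma>\<^sup>2)"
      using g1 by (simp add: sum_gp_strict divide_right_mono)
    then show "\<gamma>\<^sup>2 * (\<Sum>k<n. (\<gamma>\<^sup>2) ^ k) \<le> \<gamma>\<^sup>2 / (1 - \<gamma>\<^sup>2)"
      using mult_left_mono[OF _ g1(2)] by fastforce
  qed simp
  ultimately show ?thesis
    using fluctuation_second_moment[of n] by simp
qed

section \<open>Almost sure convergence of the series of the return\<close>

lemma C_nonneg: "0 \<le> C * norm (v :: real^'n)"
  by (rule order_trans[OF norm_ge_zero stable[of 0]])

lemma integrable_norm_square_noise: "integrable M (\<lambda>\<omega>. (norm (w k \<omega>))\<^sup>2)"
  using square_integrable_noise[of k] by (simp add: square_integrable_def)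

lemma expectation_norm_square_noise:
  "expectation (\<lambda>\<omega>. (norm (w k \<omega>))\<^sup>2) = expectation (\<lambda>\<omega>. (norm (w 0 \<omega>))\<^sup>2)"
  by (rule expectation_noise) simp

text \<open>The powers of F stay bounded, so the k-th term is at most a constant times \<gamma>^k (1
  + |w_k|^2), whose expectations form a geometric series.\<close>

lemma AE_summable_linear:
  "AE \<omega> in M. summable (\<lambda>k. \<gamma> ^ (k + 1) * (w k \<omega> \<bullet> (P *v (matpow F (k + 1) *v x))))"
proof -
  let ?p = "onorm ((*v) P)" and ?m = "expectation (\<lambda>\<omega>. (norm (w 0 \<omega>))\<^sup>2)"
  define L where "L = ?p * (C * norm x)"
  have L0: "0 \<le> L"
    unfolding L_def by (intro mult_nonneg_nonneg onorm_pos_le C_nonneg) simp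
  show ?thesis
  proof (rule AE_summable_of_integral_bound[where B = "\<lambda>k. \<gamma> ^ k * (L * (1 + ?m))"])
    fix k \<omega>
    have "norm (P *v (matpow F (k + 1) *v x)) \<le> ?p * norm (matpow F (k + 1) *v x)"
      by (rule norm_matrix_vector_mult_le)
    also have "\<dots> \<le> L"
      unfolding L_def by (intro mult_left_mono stable onorm_pos_le) simp
    finally have 1: "norm (P *v (matpow F (k + 1) *v x)) \<le> L" .
    have "\<bar>w k \<omega> \<bullet> (P *v (matpow F (k + 1) *v x))\<bar> \<le> norm (w k \<omega>) * norm (P *v (matpow F (k + 1) *v x))"
      by (rule Cauchy_Schwarz_ineq2)
    also have "\<dots> \<le> (1 + (norm (w k \<omega>))\<^sup>2) * L"
    proof (intro mult_mono 1)
      have "0 \<le> (norm (w k \<omega>) - 1)\<^sup>2 + (norm (w k \<omega>))\<^sup>2 + 1" by simp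
      then show "norm (w k \<omega>) \<le> 1 + (norm (w k \<omega>))\<^sup>2"
        by (simp add: power2_diff)
    qed auto
    finally have "\<gamma> ^ (k + 1) * \<bar>w k \<omega> \<bullet> (P *v (matpow F (k + 1) *v x))\<bar>
        \<le> \<gamma> ^ k * ((1 + (norm (w k \<omega>))\<^sup>2) * L)"
      using discount by (intro mult_mono power_decreasing) (auto simp: L0)
    then show "\<bar>\<gamma> ^ (k + 1) * (w k \<omega> \<bullet> (P *v (matpow F (k + 1) *v x)))\<bar>
        \<le> \<gamma> ^ k * ((1 + (norm (w k \<omega>))\<^sup>2) * L)"
      using discount by (simp add: abs_mult)
  next
    fix k
    show "integrable M (\<lambda>\<omega>. \<gamma> ^ k * ((1 + (norm (w k \<omega>))\<^sup>2) * L))"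
      by (simp add: integrable_norm_square_noise)
    show "expectation (\<lambda>\<omega>. \<gamma> ^ k * ((1 + (norm (w k \<omega>))\<^sup>2) * L)) \<le> \<gamma> ^ k * (L * (1 + ?m))"
      by (simp add: integrable_norm_square_noise expectation_norm_square_noise[of k] prob_space)
    show "summable (\<lambda>k. \<gamma> ^ k * (L * (1 + ?m)))"
      using discount by (intro summable_mult2 summable_geometric) simp
  qed simp
qed

lemma AE_summable_quadratic:
  "AE \<omega> in M. summable (\<lambda>k. \<gamma> ^ (k + 1) * (w k \<omega> \<bullet> (P *v w k \<omega>)))"
proof -
  let ?p = "onorm ((*v) P)" and ?m = "expectation (\<lambda>\<omega>. (norm (w 0 \<omega>))\<^sup>2)"
  have p0: "0 \<le> ?p" by (rule onorm_pos_le) simp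
  show ?thesis
  proof (rule AE_summable_of_integral_bound[where B = "\<lambda>k. \<gamma> ^ k * (?p * ?m)"])
    fix k \<omega>
    have "\<gamma> ^ (k + 1) * \<bar>w k \<omega> \<bullet> (P *v w k \<omega>)\<bar> \<le> \<gamma> ^ k * (?p * (norm (w k \<omega>))\<^sup>2)"
      using discount by (intro mult_mono power_decreasing quadratic_form_bound) (auto simp: p0)
    then show "\<bar>\<gamma> ^ (k + 1) * (w k \<omega> \<bullet> (P *v w k \<omega>))\<bar> \<le> \<gamma> ^ k * (?p * (norm (w k \<omega>))\<^sup>2)"
      using discount by (simp add: abs_mult)
  next
    fix k
    show "integrable M (\<lambda>\<omega>. \<gamma> ^ k * (?p * (norm (w k \<omega>))\<^sup>2))"
      by (simp add: integrable_norm_square_noise)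
    show "expectation (\<lambda>\<omega>. \<gamma> ^ k * (?p * (norm (w k \<omega>))\<^sup>2)) \<le> \<gamma> ^ k * (?p * ?m)"
      by (simp add: expectation_norm_square_noise[of k])
    show "summable (\<lambda>k. \<gamma> ^ k * (?p * ?m))"
      using discount by (intro summable_mult2 summable_geometric) simp
  qed simp
qed

text \<open>The inner sum has k bounded terms, so the expectations grow at most like k \<gamma>^k.
  The series starts at k = 0, where the inner sum is empty, to align it with the other two.\<close>

lemma AE_summable_bilinear:
  "AE \<omega> in M. summable (\<lambda>k. \<gamma> ^ (k + 1) *
    (w k \<omega> \<bullet> (P *v (\<Sum>\<tau><k. matpow F (k - \<tau>) *v w \<tau> \<omega>))))"
proof -
  let ?p = "onorm ((*v) P)" and ?m = "expectation (\<lambda>\<omega>. (norm (w 0 \<omega>))\<^sup>2)"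
  have p0: "0 \<le> ?p" by (rule onorm_pos_le) simp
  \<comment> \<open>Truncation at 0 gives a factor whose nonnegativity is immediate.\<close>
  define c where "c = max C 0"
  have c: "norm (matpow F k *v v) \<le> c * norm v" "0 \<le> c" for k and v :: "real^'n"
    by (rule order_trans[OF stable], rule mult_right_mono) (auto simp: c_def)
  \<comment> \<open>Products |w_k| |w_\<tau>| are dominated by sums of squares, so second moments
    suffice for integrability.\<close>
  define h where "h k \<omega> = (\<Sum>\<tau><k. (norm (w k \<omega>))\<^sup>2 + (norm (w \<tau> \<omega>))\<^sup>2)" for k \<omega>
  have norm_square: "has_bochner_integral M (\<lambda>\<omega>. (norm (w k \<omega>))\<^sup>2) ?m" for k
    using expectation_norm_square_noise[of k]
    by (simp add: has_bochner_integral_iff integrable_norm_square_noise)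
  have hb: "has_bochner_integral M (h k) (real k * (2 * ?m))" for k
  proof -
    have "has_bochner_integral M (h k) (\<Sum>\<tau><k. ?m + ?m)"
      unfolding h_def[abs_def] by (intro has_bochner_integral_sum has_bochner_integral_add norm_square)
    then show ?thesis by simp
  qed
  show ?thesis
  proof (rule AE_summable_of_integral_bound[where B = "\<lambda>k. (real k * \<gamma> ^ k) * (?p * c * (2 * ?m))"])
    fix k \<omega>
    let ?s = "\<Sum>\<tau><k. matpow F (k - \<tau>) *v w \<tau> \<omega>"
    have "\<bar>w k \<omega> \<bullet> (P *v ?s)\<bar> \<le> norm (w k \<omega>) * norm (P *v ?s)"
      by (rule Cauchy_Schwarz_ineq2)
    also have "\<dots> \<le> norm (w k \<omega>) * (?p * (\<Sum>\<tau><k. c * norm (w \<tau> \<omega>)))"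
    proof (rule mult_left_mono)
      have "norm (P *v ?s) \<le> ?p * norm ?s"
        by (rule norm_matrix_vector_mult_le)
      also have "\<dots> \<le> ?p * (\<Sum>\<tau><k. c * norm (w \<tau> \<omega>))"
        by (intro mult_left_mono sum_norm_le c p0)
      finally show "norm (P *v ?s) \<le> ?p * (\<Sum>\<tau><k. c * norm (w \<tau> \<omega>))" .
    qed simp
    also have "\<dots> = ?p * c * (\<Sum>\<tau><k. norm (w k \<omega>) * norm (w \<tau> \<omega>))"
      by (simp add: sum_distrib_left ac_simps)
    also have "\<dots> \<le> ?p * c * h k \<omega>"
      unfolding h_def
    proof (intro mult_left_mono sum_mono mult_nonneg_nonneg p0 c)
      fix \<tau>
      have "2 * norm (w k \<omega>) * norm (w \<tau> \<omega>) \<le> (norm (w k \<omega>))\<^sup>2 + (norm (w \<tau> \<omega>))\<^sup>2"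
        by (rule sum_squares_bound)
      moreover have "0 \<le> norm (w k \<omega>) * norm (w \<tau> \<omega>)" by simp
      ultimately show "norm (w k \<omega>) * norm (w \<tau> \<omega>) \<le> (norm (w k \<omega>))\<^sup>2 + (norm (w \<tau> \<omega>))\<^sup>2"
        by linarith
    qed
    finally have "\<gamma> ^ (k + 1) * \<bar>w k \<omega> \<bullet> (P *v ?s)\<bar> \<le> \<gamma> ^ k * (?p * c * h k \<omega>)"
      using discount by (intro mult_mono power_decreasing)
        (auto simp: p0 c h_def intro!: mult_nonneg_nonneg sum_nonneg)
    then show "\<bar>\<gamma> ^ (k + 1) * (w k \<omega> \<bullet> (P *v ?s))\<bar> \<le> \<gamma> ^ k * (?p * c * h k \<omega>)"
      using discount by (simp add: abs_mult)
  next
    fix k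
    show "integrable M (\<lambda>\<omega>. \<gamma> ^ k * (?p * c * h k \<omega>))"
      using hb[of k] by (simp add: has_bochner_integral_iff)
    show "expectation (\<lambda>\<omega>. \<gamma> ^ k * (?p * c * h k \<omega>)) \<le> (real k * \<gamma> ^ k) * (?p * c * (2 * ?m))"
      using hb[of k] by (simp add: has_bochner_integral_iff)
    show "summable (\<lambda>k. (real k * \<gamma> ^ k) * (?p * c * (2 * ?m)))"
      using discount by (intro summable_mult2 summable_of_nat_mult_power) simp
  qed simp
qed

text \<open>The termwise expectations of the return added up. It serves as the centre of the second
  moment, and its equality with the expectation is never invoked.\<close>

definition mean_return :: real where
  "mean_return = x \<bullet> (P *v x) + \<gamma> / (1 - \<gamma>) * trace (P ** \<Sigma>)"

text \<open>Where all three series converge, each \<open>suminf\<close> in the return is a genuine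
  sum and the series may be added term by term.\<close>

lemma AE_fluctuation_tendsto:
  "AE \<omega> in M. (\<lambda>n. fluctuation n \<omega>) \<longlonglongrightarrow> random_return \<gamma> F P w x \<omega> - mean_return"
  using AE_summable_linear AE_summable_quadratic AE_summable_bilinear
proof eventually_elim
  case (elim \<omega>)
  let ?a = "\<lambda>k. \<gamma> ^ (k + 1) * (w k \<omega> \<bullet> (P *v (matpow F (k + 1) *v x)))"
  let ?b = "\<lambda>k. \<gamma> ^ (k + 1) * (w k \<omega> \<bullet> (P *v w k \<omega>))"
  let ?c = "\<lambda>k. \<gamma> ^ (k + 1) * (w k \<omega> \<bullet> (P *v (\<Sum>\<tau><k. matpow F (k - \<tau>) *v w \<tau> \<omega>)))"
  have "(\<lambda>k. \<gamma> ^ k) sums (1 / (1 - \<gamma>))"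
    using discount by (intro geometric_sums) simp
  then have geom: "(\<lambda>k. \<gamma> * trace (P ** \<Sigma>) * \<gamma> ^ k) sums (\<gamma> * trace (P ** \<Sigma>) * (1 / (1 - \<gamma>)))"
    by (rule sums_mult)
  \<comment> \<open>The term at k = 0 has an empty inner sum, so dropping it gives the shifted
    series of \<open>random_return\<close>.\<close>
  have c: "suminf ?c = (\<Sum>k. \<gamma> ^ (k + 2) *
      (w (Suc k) \<omega> \<bullet> (P *v (\<Sum>\<tau><Suc k. matpow F (Suc k - \<tau>) *v w \<tau> \<omega>))))"
    using suminf_split_head[OF elim(3)] by simp
  have "(\<lambda>k. 2 * ?a k + ?b k + 2 * ?c k - \<gamma> * trace (P ** \<Sigma>) * \<gamma> ^ k) sums
      (2 * suminf ?a + suminf ?b + 2 * suminf ?c - \<gamma> * trace (P ** \<Sigma>) * (1 / (1 - \<gamma>)))"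
    by (intro sums_add sums_diff sums_mult summable_sums elim geom)
  also have "2 * suminf ?a + suminf ?b + 2 * suminf ?c - \<gamma> * trace (P ** \<Sigma>) * (1 / (1 - \<gamma>))
      = random_return \<gamma> F P w x \<omega> - mean_return"
    unfolding random_return_def mean_return_def c by simp
  also have "(\<lambda>k. 2 * ?a k + ?b k + 2 * ?c k - \<gamma> * trace (P ** \<Sigma>) * \<gamma> ^ k)
      = (\<lambda>k. \<gamma> ^ Suc k * (2 * (w k \<omega> \<bullet> (P *v drift k \<omega>)) + q (w k \<omega>)))"
    by (simp add: fun_eq_iff drift_eq q_def matrix_vector_right_distrib inner_add_right algebra_simps
      del: matpow.simps)
  finally show ?case
    by (simp add: sums_def fluctuation_def[abs_def])
qed

lemma measurable_random_return [measurable]: "random_return \<gamma> F P w x \<in> borel_measurable M"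
  unfolding random_return_def[abs_def] by measurable

lemma random_return_variance_le:
  assumes "\<And>u. 0 \<le> u \<bullet> (\<Sigma> *v u)"
    and "Z - \<gamma>\<^sup>2 *\<^sub>R (F ** Z ** transpose F) =
      F ** (outer_prod x x + (\<gamma>\<^sup>2 / (1 - \<gamma>\<^sup>2)) *\<^sub>R \<Sigma>) ** transpose F"
  shows "square_integrable M (random_return \<gamma> F P w x) \<and>
    variance (random_return \<gamma> F P w x) \<le>
      \<gamma>\<^sup>2 / (1 - \<gamma>\<^sup>2) * expectation (\<lambda>\<omega>. (q (w 0 \<omega>))\<^sup>2) + 4 * \<gamma>\<^sup>2 * trace (P ** \<Sigma> ** P ** Z)"
proof -
  let ?G = "random_return \<gamma> F P w x"
  have "square_integrable M (\<lambda>\<omega>. ?G \<omega> - mean_return) \<and> expectation (\<lambda>\<omega>. (?G \<omega> - mean_return)\<^sup>2) \<le>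
      \<gamma>\<^sup>2 / (1 - \<gamma>\<^sup>2) * expectation (\<lambda>\<omega>. (q (w 0 \<omega>))\<^sup>2) + 4 * \<gamma>\<^sup>2 * trace (P ** \<Sigma> ** P ** Z)"
    using fluctuation_second_moment fluctuation_second_moment_le[OF assms] AE_fluctuation_tendsto
    by (intro square_integrable_limit[where f = fluctuation]) auto
  moreover from this have "square_integrable M ?G"
    using square_integrable_add[OF _ square_integrable_const, of "\<lambda>\<omega>. ?G \<omega> - mean_return" mean_return] by simp
  ultimately show ?thesis
    using variance_le_second_moment_about[of ?G mean_return] by linarith
qed

end

text \<open>The integrability claims ensure that the variance is not built from default values of
  the Bochner integral. The operator norm of P for the Euclidean norm is its spectral norm.\<close>

theorem corollary1:
  fixes A :: "real^'n^'n" and B :: "real^'m^'n"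
    and Q :: "real^'n^'n" and R :: "real^'m^'m"
    and K :: "real^'n^'m" and A\<^sub>K :: "real^'n^'n"
    and P Z \<Sigma> :: "real^'n^'n"
    and \<gamma> \<phi> :: real and x :: "real^'n"
    and M :: "'a measure" and w :: "nat \<Rightarrow> 'a \<Rightarrow> real^'n" and W :: "'a \<Rightarrow> real^'n"
  assumes Q: "sym_pos_def Q" and R: "sym_pos_def R"
    and \<gamma>: "0 < \<gamma>" "\<gamma> < 1"
    and A\<^sub>K: "A\<^sub>K = A + B ** K" and stable: "spectral_radius A\<^sub>K < 1"
    and M: "prob_space M"
    and indep: "prob_space.indep_vars M (\<lambda>_. borel) w UNIV"
    and W: "W \<in> borel_measurable M"
    and law: "\<And>k. distr M borel (w k) = distr M borel W"
    and mean: "\<And>k. integral\<^sup>L M (w k) = 0"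
    and cov: "\<And>k. covariance_matrix M (w k) = \<Sigma>" and \<Sigma>: "sym_pos_def \<Sigma>"
    and symmetric: "\<And>k. distr M borel (w k) = distr M borel (\<lambda>\<omega>. - w k \<omega>)"
    and moment4: "integrable M (\<lambda>\<omega>. norm (W \<omega>) ^ 4)"
      "integral\<^sup>L M (\<lambda>\<omega>. norm (W \<omega>) ^ 4) = \<phi> ^ 4"
    and P: "P = Q + transpose K ** R ** K + \<gamma> *\<^sub>R (transpose A\<^sub>K ** P ** A\<^sub>K)"
    and Z: "Z - \<gamma>\<^sup>2 *\<^sub>R (A\<^sub>K ** Z ** transpose A\<^sub>K) =
      A\<^sub>K ** (outer_prod x x + (\<gamma>\<^sup>2 / (1 - \<gamma>\<^sup>2)) *\<^sub>R \<Sigma>) ** transpose A\<^sub>K"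
  shows "integrable M (random_return \<gamma> A\<^sub>K P w x) \<and>
    integrable M (\<lambda>\<omega>. (random_return \<gamma> A\<^sub>K P w x \<omega>)\<^sup>2) \<and>
    prob_space.variance M (random_return \<gamma> A\<^sub>K P w x)
      \<le> \<gamma>\<^sup>2 / (1 - \<gamma>\<^sup>2) * (onorm ((*v) P))\<^sup>2 * \<phi> ^ 4
        - \<gamma>\<^sup>2 / (1 - \<gamma>\<^sup>2) * (trace (P ** \<Sigma>))\<^sup>2
        + 4 * \<gamma>\<^sup>2 * trace (P ** \<Sigma> ** P ** Z)"
proof -
  interpret prob_space M by (rule M)
  have wm [measurable]: "w k \<in> borel_measurable M" for k
    using indep by (auto simp: indep_vars_def)
  have w4: "(\<integral>\<omega>. norm (w 0 \<omega>) ^ 4 \<partial>M) = \<phi> ^ 4" and i4: "integrable M (\<lambda>\<omega>. norm (w 0 \<omega>) ^ 4)"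
  proof -
    have "(\<integral>\<omega>. norm (w 0 \<omega>) ^ 4 \<partial>M) = (\<integral>v. norm v ^ 4 \<partial>distr M borel (w 0))"
      by (rule integral_distr[symmetric]) auto
    also have "\<dots> = (\<integral>\<omega>. norm (W \<omega>) ^ 4 \<partial>M)"
      unfolding law by (rule integral_distr) (use W in auto)
    finally show "(\<integral>\<omega>. norm (w 0 \<omega>) ^ 4 \<partial>M) = \<phi> ^ 4"
      using moment4 by simp
    have "integrable M (\<lambda>\<omega>. norm (w 0 \<omega>) ^ 4) = integrable (distr M borel (w 0)) (\<lambda>v. norm v ^ 4)"
      by (rule integrable_distr_eq[symmetric]) auto
    also have "\<dots> = integrable M (\<lambda>\<omega>. norm (W \<omega>) ^ 4)"
      unfolding law by (rule integrable_distr_eq) (use W in auto)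
    finally show "integrable M (\<lambda>\<omega>. norm (w 0 \<omega>) ^ 4)"
      using moment4 by simp
  qed
  \<comment> \<open>Symmetry equates each component mean with its negative; with mean zero, the
    covariance matrix is the second moment matrix.\<close>
  have comp: "(\<integral>\<omega>. w k \<omega> $ i \<partial>M) = 0" for k i
  proof -
    have "(\<integral>\<omega>. w k \<omega> $ i \<partial>M) = (\<integral>v. v $ i \<partial>distr M borel (w k))"
      by (rule integral_distr[symmetric]) auto
    also have "\<dots> = (\<integral>v. v $ i \<partial>distr M borel (\<lambda>\<omega>. - w k \<omega>))"
      by (subst symmetric) simp
    also have "\<dots> = (\<integral>\<omega>. - w k \<omega> $ i \<partial>M)"
      by (subst integral_distr) auto
    finally show ?thesis by simp
  qed
  interpret symmetric_iid_noise M w \<Sigma>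
  proof
    show "indep_vars (\<lambda>_. borel) w UNIV" by (rule indep)
    show "distr M borel (w k) = distr M borel (w 0)" for k by (simp only: law)
    show "distr M borel (w k) = distr M borel (\<lambda>\<omega>. - w k \<omega>)" for k by (rule symmetric)
    show "second_moment M (w k) = \<Sigma>" for k
      using cov[of k] by (simp add: covariance_matrix_def second_moment_def comp)
  qed (rule i4)
  obtain C where C: "\<And>k v. norm (matpow A\<^sub>K k *v v) \<le> C * norm v"
    using matpow_bounded[OF stable] by blast
  have "transpose P = P"
  proof -
    have tr: "transpose (X + Y) = transpose X + transpose Y" "transpose (c *\<^sub>R X) = c *\<^sub>R transpose X"
      for X Y :: "real^'n^'n" and c
      by (simp_all add: transpose_def vec_eq_iff)
    \<comment> \<open>Q and R are symmetric, so the transpose solves the same affine equation as P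
      and the difference solves the homogeneous one.\<close>
    have "transpose P = Q + transpose K ** R ** K + \<gamma> *\<^sub>R (transpose A\<^sub>K ** transpose P ** A\<^sub>K)"
      using arg_cong[OF P, of transpose] Q R
      by (simp add: tr matrix_transpose_mul matrix_mul_assoc sym_pos_def_def)
    with P have "P - transpose P = \<gamma> *\<^sub>R (transpose A\<^sub>K ** P ** A\<^sub>K) - \<gamma> *\<^sub>R (transpose A\<^sub>K ** transpose P ** A\<^sub>K)"
      by (metis add_diff_cancel_left)
    also have "\<dots> = \<gamma> *\<^sub>R (transpose A\<^sub>K ** (P - transpose P) ** A\<^sub>K)"
      by (simp add: matrix_matrix_mult_def vec_eq_iff left_diff_distrib right_diff_distrib sum_subtractf)
    finally have "P - transpose P = 0"
      using \<gamma> C by (intro discounted_invariant_form_eq_0[of \<gamma> A\<^sub>K C]) auto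
    then show ?thesis by simp
  qed
  then interpret closed_loop M w \<Sigma> A\<^sub>K P x \<gamma> C
    by unfold_locales (use \<gamma> C in auto)
  let ?G = "random_return \<gamma> A\<^sub>K P w x"
  have "0 \<le> u \<bullet> (\<Sigma> *v u)" for u
    using \<Sigma> by (cases "u = 0") (auto simp: sym_pos_def_def less_imp_le)
  from random_return_variance_le[OF this Z]
  have G: "square_integrable M ?G" and var: "variance ?G \<le>
      \<gamma>\<^sup>2 / (1 - \<gamma>\<^sup>2) * expectation (\<lambda>\<omega>. (q (w 0 \<omega>))\<^sup>2) + 4 * \<gamma>\<^sup>2 * trace (P ** \<Sigma> ** P ** Z)"
    by auto
  have "\<gamma>\<^sup>2 < 1" using \<gamma> by (simp add: power_less_one_iff)
  then have "\<gamma>\<^sup>2 / (1 - \<gamma>\<^sup>2) * expectation (\<lambda>\<omega>. (q (w 0 \<omega>))\<^sup>2)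
      \<le> \<gamma>\<^sup>2 / (1 - \<gamma>\<^sup>2) * ((onorm ((*v) P))\<^sup>2 * \<phi> ^ 4 - (trace (P ** \<Sigma>))\<^sup>2)"
    using expectation_q_square_le unfolding w4 by (intro mult_left_mono) auto
  with var have "variance ?G \<le> \<gamma>\<^sup>2 / (1 - \<gamma>\<^sup>2) * (onorm ((*v) P))\<^sup>2 * \<phi> ^ 4
        - \<gamma>\<^sup>2 / (1 - \<gamma>\<^sup>2) * (trace (P ** \<Sigma>))\<^sup>2 + 4 * \<gamma>\<^sup>2 * trace (P ** \<Sigma> ** P ** Z)"
    by (simp only: right_diff_distrib mult.assoc)
  with G show ?thesis
    by (simp add: square_integrable_imp_integrable) (simp add: square_integrable_def)
qed

end
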